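(* Let $m \ge 1$ and $b \ge 2m$ be integers. Then Breaker can guarantee to win the $(m,b)$ Maker-Breaker percolation game on $\mathbb{Z}^2$ within the first $40$ rounds of the game. Moreover, if $m \ge 29$ then Breaker can guarantee to win within $3$ rounds.
   Context: $\mathbb{Z}^2$ denotes the square lattice: the infinite graph whose vertices are the points $(x,y)$ with $x,y\in\mathbb{Z}$, two points being joined by an edge iff $|x-x'|+|y-y'|=1$. Fix an origin vertex $v_0$. The $(m,b)$ Maker-Breaker percolation game on $\mathbb{Z}^2$ is played on the edge set of $\mathbb{Z}^2$. In each round $1,2,3,\dots$, first Maker claims $m$ as yet unclaimed edges, then Breaker claims $b$ as yet unclaimed edges. Breaker wins if at some finite point of the game he has claimed at least one edge of every infinite connected subgraph of $\mathbb{Z}^2$ containing $v_0$; equivalently, if the connected component of $v_0$ in the graph formed by Maker's edges and the unclaimed edges becomes finite. Otherwise Maker wins. *)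

theory Defs imports Main begin

type_synonym vertex = "int \<times> int"
type_synonym edge = "vertex set"

definition Z2_edges :: "edge set" where
  "Z2_edges = {{(x, y), (x', y')} | x y x' y'. \<bar>x - x'\<bar> + \<bar>y - y'\<bar> = 1}"

definition Z2_subgraph :: "vertex set \<Rightarrow> edge set \<Rightarrow> bool" where
  "Z2_subgraph V E \<longleftrightarrow> E \<subseteq> Z2_edges \<and> \<Union>E \<subseteq> V"

definition edge_rel :: "edge set \<Rightarrow> (vertex \<times> vertex) set" where
  "edge_rel E = {(u, v). {u, v} \<in> E}"

definition connected_graph :: "vertex set \<Rightarrow> edge set \<Rightarrow> bool" where
  "connected_graph V E \<longleftrightarrow> (\<forall>u\<in>V. \<forall>v\<in>V. (u, v) \<in> (edge_rel E)\<^sup>*)"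

definition breaker_has_won :: "vertex \<Rightarrow> edge set \<Rightarrow> bool" where
  "breaker_has_won v0 B \<longleftrightarrow>
     (\<forall>V E. Z2_subgraph V E \<longrightarrow> connected_graph V E \<longrightarrow> infinite V \<longrightarrow> v0 \<in> V \<longrightarrow> E \<inter> B \<noteq> {})"

lemma breaker_has_won_iff_finite_component:
  "breaker_has_won v0 B \<longleftrightarrow> finite ((edge_rel (Z2_edges - B))\<^sup>* `` {v0})"
proof
  let ?R = "edge_rel (Z2_edges - B)"
  let ?C = "?R\<^sup>* `` {v0}"
  let ?F = "{e \<in> Z2_edges - B. e \<subseteq> ?C}"
  have sym: "sym ((edge_rel E)\<^sup>*)" for E
    by (rule sym_rtrancl) (auto simp: sym_def edge_rel_def insert_commute)
  have from_v0: "(v0, v) \<in> (edge_rel ?F)\<^sup>*" if "(v0, v) \<in> ?R\<^sup>*" for v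
    using that
  proof (induction rule: rtrancl_induct)
    case (step y z)
    then have "(v0, z) \<in> ?R\<^sup>*" by (meson rtrancl.rtrancl_into_rtrancl)
    with step have "(y, z) \<in> edge_rel ?F" by (auto simp: edge_rel_def)
    with step.IH show ?case by (rule rtrancl.rtrancl_into_rtrancl)
  qed simp
  have "connected_graph ?C ?F"
    unfolding connected_graph_def
  proof (intro ballI)
    fix u v assume "u \<in> ?C" "v \<in> ?C"
    then have "(v0, u) \<in> (edge_rel ?F)\<^sup>*" "(v0, v) \<in> (edge_rel ?F)\<^sup>*"
      using from_v0 by (simp_all only: Image_singleton_iff)
    then show "(u, v) \<in> (edge_rel ?F)\<^sup>*" by (rule rtrancl_trans[OF symD[OF sym]])
  qed
  moreover have "Z2_subgraph ?C ?F" "v0 \<in> ?C" "?F \<inter> B = {}"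
    by (auto simp: Z2_subgraph_def)
  moreover assume "breaker_has_won v0 B"
  ultimately show "finite ?C" unfolding breaker_has_won_def by blast
next
  assume fin: "finite ((edge_rel (Z2_edges - B))\<^sup>* `` {v0})"
  show "breaker_has_won v0 B"
    unfolding breaker_has_won_def
  proof (intro allI impI notI)
    fix V E
    assume *: "Z2_subgraph V E" "connected_graph V E" "infinite V" "v0 \<in> V" "E \<inter> B = {}"
    then have "edge_rel E \<subseteq> edge_rel (Z2_edges - B)"
      by (auto simp: Z2_subgraph_def edge_rel_def)
    then have "(edge_rel E)\<^sup>* \<subseteq> (edge_rel (Z2_edges - B))\<^sup>*" by (rule rtrancl_mono)
    with * have "V \<subseteq> (edge_rel (Z2_edges - B))\<^sup>* `` {v0}"
      by (auto simp: connected_graph_def)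
    with fin \<open>infinite V\<close> show False using finite_subset by blast
  qed
qed

text \<open>
  Rounds are indexed from 0, so \<open>M i\<close> is the set of edges that Maker claims in the
  (\<open>i + 1\<close>)-st round. Breaker's own earlier moves are determined by his strategy and
  Maker's moves, so it suffices that a strategy reads the list of Maker's moves so far,
  the one of the current round included.
\<close>

type_synonym strategy = "edge set list \<Rightarrow> edge set"

definition breaker_move :: "strategy \<Rightarrow> (nat \<Rightarrow> edge set) \<Rightarrow> nat \<Rightarrow> edge set" where
  "breaker_move \<sigma> M i = \<sigma> (map M [0..<Suc i])"

definition maker_edges :: "(nat \<Rightarrow> edge set) \<Rightarrow> nat \<Rightarrow> edge set" where
  "maker_edges M k = (\<Union>i<k. M i)"

definition breaker_edges :: "strategy \<Rightarrow> (nat \<Rightarrow> edge set) \<Rightarrow> nat \<Rightarrow> edge set" where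
  "breaker_edges \<sigma> M k = (\<Union>i<k. breaker_move \<sigma> M i)"

definition maker_legal :: "nat \<Rightarrow> strategy \<Rightarrow> (nat \<Rightarrow> edge set) \<Rightarrow> nat \<Rightarrow> bool" where
  "maker_legal m \<sigma> M i \<longleftrightarrow>
     M i \<subseteq> Z2_edges - (maker_edges M i \<union> breaker_edges \<sigma> M i) \<and>
     finite (M i) \<and> card (M i) = m"

definition breaker_legal :: "nat \<Rightarrow> strategy \<Rightarrow> (nat \<Rightarrow> edge set) \<Rightarrow> nat \<Rightarrow> bool" where
  "breaker_legal b \<sigma> M i \<longleftrightarrow>
     breaker_move \<sigma> M i \<subseteq> Z2_edges - (maker_edges M (Suc i) \<union> breaker_edges \<sigma> M i) \<and>
     finite (breaker_move \<sigma> M i) \<and> card (breaker_move \<sigma> M i) = b"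

text \<open>
  A strategy has to answer legally after every legal initial segment of Maker's moves.
  Hence Breaker cannot win by leaving Maker without a legal move: only finitely many
  edges are ever claimed, so each legal initial segment extends to an infinite legal play.
\<close>

definition legal_strategy :: "nat \<Rightarrow> nat \<Rightarrow> strategy \<Rightarrow> bool" where
  "legal_strategy m b \<sigma> \<longleftrightarrow>
     (\<forall>M k. (\<forall>i\<le>k. maker_legal m \<sigma> M i) \<longrightarrow> breaker_legal b \<sigma> M k)"

definition breaker_wins_within :: "nat \<Rightarrow> nat \<Rightarrow> vertex \<Rightarrow> nat \<Rightarrow> bool" where
  "breaker_wins_within m b v0 n \<longleftrightarrow>
     (\<exists>\<sigma>. legal_strategy m b \<sigma> \<and>
       (\<forall>M. (\<forall>i. maker_legal m \<sigma> M i) \<longrightarrow>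
         (\<exists>k\<le>n. breaker_has_won v0 (breaker_edges \<sigma> M k))))"

end

theory Submission imports Defs begin

text \<open>
  Breaker thinks in terms of a finite region \<open>S\<close> around \<open>v0\<close>: he has won as soon as he owns the whole
  edge boundary of some such \<open>S\<close>. Give \<open>S\<close> the potential

    (boundary edges of \<open>S\<close> not owned by Breaker) + 2 (Maker edges not inside \<open>S\<close>).

  If a Maker edge leads from \<open>S\<close> to a vertex \<open>x\<close> outside, then adding \<open>x\<close> to \<open>S\<close> loses that boundary edge,
  adds at most the three other edges at \<open>x\<close>, and takes a Maker edge inside; so the potential does not
  grow, and a region of potential at most \<open>2 * m\<close> grows into one that no Maker edge leaves and that
  Breaker can seal at once with \<open>2 * m\<close> edges (\<open>can_reply_if_potential_small\<close>). Maker edges played far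
  away need no separate treatment, because they are paid for in the potential from the start.
  The region \<open>{v0}\<close> has potential 4, a move of Maker adds at most \<open>2 * m\<close>, and Breaker's reply takes
  \<open>2 * m\<close> away again. So Breaker can hold the potential at 4 and has to gain 4 more. He gains
  by his choice of the boundary edges that he leaves open, the gates; there are at most four of them.

  For every \<open>m \<ge> 1\<close>, 15 rounds suffice. Breaker keeps all gates on the boundary of two edge-disjoint unit
  squares, initially two squares that meet in \<open>v0\<close>. A vertex at which Maker enters belongs to
  such a square, so at least two of its edges are already accounted for, and the edges to be
  claimed outside the squares never exceed \<open>2 * m\<close>. Each entry brings a square closer to lying inside the
  region, where it has no gates. A Maker edge that stays outside gives Breaker two spare
  edges, with which he shuts one of the squares; when Maker later enters through the other one, the
  opposite square at the entrance takes the place of the lost one (\<open>two_square_reply\<close>,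
  \<open>guarded_squares_win\<close>).

  For \<open>m \<ge> 29\<close>, three rounds suffice. After Maker's first move some rectangle
  around \<open>v0\<close> with semiperimeter at most \<open>m + 2\<close> is left by none of her edges. Either Breaker seals it, or it
  has a side of at least 15 vertices, and Breaker leaves up to four gates on this side, away from its ends. What
  Maker builds through them is enclosed in a rectangular tower on a floor. Widening the tower gains one,
  because the floor is already sealed, so the tower is narrow and therefore high (\<open>tower_reply\<close>). Breaker
  leaves the gates at the foot of the tower, in the corner between tower and floor. A rectangle in this
  corner has only two open sides, so every enlargement gains one, and Breaker can seal after
  Maker's third move (\<open>pocket_reply\<close>).
\<close>

section \<open>Enclosing regions and the game\<close>

definition edge_boundary :: "vertex set \<Rightarrow> edge set" where
  "edge_boundary S = {e \<in> Z2_edges. e \<inter> S \<noteq> {} \<and> \<not> e \<subseteq> S}"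

definition sealed :: "vertex \<Rightarrow> edge set \<Rightarrow> bool" where
  "sealed v0 B \<longleftrightarrow> (\<exists>S. finite S \<and> v0 \<in> S \<and> edge_boundary S \<subseteq> B)"

text \<open>
  The position in which Maker and Breaker own \<open>M\<close> and \<open>B\<close> and Maker is to move is won for Breaker in
  \<open>n\<close> rounds. Breaker may claim fewer than \<open>2 * m\<close> edges here, so that only useful edges
  have to be named; monotonicity in \<open>B\<close> allows him to fill up his moves later.
\<close>

fun wins :: "nat \<Rightarrow> vertex \<Rightarrow> nat \<Rightarrow> edge set \<Rightarrow> edge set \<Rightarrow> bool" where
  "wins m v0 0 M B \<longleftrightarrow> sealed v0 B"
| "wins m v0 (Suc n) M B \<longleftrightarrow> sealed v0 B \<or>
     (\<forall>X. X \<subseteq> Z2_edges - (M \<union> B) \<longrightarrow> finite X \<longrightarrow> card X = m \<longrightarrow>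
       (\<exists>Y. Y \<subseteq> Z2_edges - (M \<union> X \<union> B) \<and> finite Y \<and> card Y \<le> 2 * m \<and>
         wins m v0 n (M \<union> X) (B \<union> Y)))"

text \<open>
  The same for a position with Breaker to move, \<open>M\<close> including the edges that Maker has just claimed.
\<close>

definition can_reply :: "nat \<Rightarrow> vertex \<Rightarrow> nat \<Rightarrow> edge set \<Rightarrow> edge set \<Rightarrow> bool" where
  "can_reply m v0 n M B \<longleftrightarrow>
     (\<exists>Y. Y \<subseteq> Z2_edges - (M \<union> B) \<and> finite Y \<and> card Y \<le> 2 * m \<and> wins m v0 n M (B \<union> Y))"

lemma sealed_mono: "sealed v0 B \<Longrightarrow> B \<subseteq> B' \<Longrightarrow> sealed v0 B'"
  unfolding sealed_def by blast

lemma sealed_imp_won: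
  assumes "sealed v0 B"
  shows "breaker_has_won v0 B"
proof -
  obtain S where S: "finite S" "v0 \<in> S" "edge_boundary S \<subseteq> B"
    using assms by (auto simp: sealed_def)
  have "v \<in> S" if "(v0, v) \<in> (edge_rel (Z2_edges - B))\<^sup>*" for v
    using that
  proof (induction rule: rtrancl_induct)
    case (step y z)
    then show ?case using S(3) by (auto simp: edge_rel_def edge_boundary_def)
  qed (use S in simp)
  then have "(edge_rel (Z2_edges - B))\<^sup>* `` {v0} \<subseteq> S" by auto
  then show ?thesis
    unfolding breaker_has_won_iff_finite_component using S(1) finite_subset by blast
qed

lemma sealed_imp_wins: "sealed v0 B \<Longrightarrow> wins m v0 n M B"
  by (cases n) (auto simp: wins.simps(2))

lemma wins_Suc_iff:
  "wins m v0 (Suc n) M B \<longleftrightarrow> sealed v0 B \<or>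
     (\<forall>X. X \<subseteq> Z2_edges - (M \<union> B) \<longrightarrow> finite X \<longrightarrow> card X = m \<longrightarrow> can_reply m v0 n (M \<union> X) B)"
  by (simp add: can_reply_def)

declare wins.simps(2) [simp del]

lemma wins_mono_claimed: "wins m v0 n M B \<Longrightarrow> B \<subseteq> B' \<Longrightarrow> wins m v0 n M B'"
proof (induction n arbitrary: M B B')
  case 0
  then show ?case using sealed_mono by auto
next
  case (Suc n)
  show ?case
  proof (cases "sealed v0 B")
    case True
    then show ?thesis using Suc.prems sealed_mono wins_Suc_iff by blast
  next
    case False
    have "can_reply m v0 n (M \<union> X) B'"
      if "X \<subseteq> Z2_edges - (M \<union> B')" "finite X" "card X = m" for X
    proof -
      have "X \<subseteq> Z2_edges - (M \<union> B)" using that Suc.prems(2) by blast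
      then have "can_reply m v0 n (M \<union> X) B"
        using Suc.prems(1) False that(2,3) unfolding wins_Suc_iff by blast
      then obtain Y where Y: "Y \<subseteq> Z2_edges - (M \<union> X \<union> B)" "finite Y" "card Y \<le> 2 * m"
          "wins m v0 n (M \<union> X) (B \<union> Y)"
        unfolding can_reply_def by blast
      have "wins m v0 n (M \<union> X) (B' \<union> (Y - B'))"
        by (rule Suc.IH[OF Y(4)]) (use Suc.prems(2) in blast)
      moreover have "card (Y - B') \<le> 2 * m"
        using Y(2,3) by (meson Diff_subset card_mono le_trans)
      moreover have "Y - B' \<subseteq> Z2_edges - (M \<union> X \<union> B')" using Y(1) by blast
      ultimately show ?thesis unfolding can_reply_def using Y(2) by blast
    qed
    then show ?thesis unfolding wins_Suc_iff by blast
  qed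
qed

lemma wins_Suc: "wins m v0 n M B \<Longrightarrow> wins m v0 (Suc n) M B"
proof (induction n arbitrary: M B)
  case 0
  then show ?case by (simp add: sealed_imp_wins)
next
  case (Suc n)
  show ?case
  proof (cases "sealed v0 B")
    case False
    then have *: "can_reply m v0 n (M \<union> X) B"
      if "X \<subseteq> Z2_edges - (M \<union> B)" "finite X" "card X = m" for X
      using Suc.prems that unfolding wins_Suc_iff by blast
    have "can_reply m v0 (Suc n) (M \<union> X) B"
      if "X \<subseteq> Z2_edges - (M \<union> B)" "finite X" "card X = m" for X
      using *[OF that] Suc.IH unfolding can_reply_def by blast
    then show ?thesis unfolding wins_Suc_iff by blast
  qed (simp add: sealed_imp_wins)
qed

lemma wins_mono:
  assumes "wins m v0 n M B" "n \<le> n'"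
  shows "wins m v0 n' M B"
  using assms(2,1) by (induction n' rule: dec_induct) (simp_all add: wins_Suc)

lemma infinite_Z2_edges: "infinite Z2_edges"
proof -
  let ?f = "\<lambda>x::int. {(x, 0::int), (x, 1)}"
  have "inj ?f" by (auto simp: inj_on_def doubleton_eq_iff)
  moreover have "range ?f \<subseteq> Z2_edges" unfolding Z2_edges_def by force
  ultimately show ?thesis using finite_imageD infinite_UNIV_int finite_subset by blast
qed

text \<open>
  The condition on winning is an implication because a strategy has to move legally in lost positions, too.
\<close>

definition replies :: "nat \<Rightarrow> nat \<Rightarrow> vertex \<Rightarrow> nat \<Rightarrow> edge set \<Rightarrow> edge set \<Rightarrow> edge set set" where
  "replies m b v0 n M B = {Y. Y \<subseteq> Z2_edges - (M \<union> B) \<and> finite Y \<and> card Y = b \<and>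
     (can_reply m v0 n M B \<longrightarrow> wins m v0 n M (B \<union> Y))}"

lemma replies_nonempty:
  assumes "finite M" "finite B" "2 * m \<le> b"
  shows "replies m b v0 n M B \<noteq> {}"
proof -
  obtain Y0 where Y0: "Y0 \<subseteq> Z2_edges - (M \<union> B)" "finite Y0" "card Y0 \<le> b"
      "can_reply m v0 n M B \<longrightarrow> wins m v0 n M (B \<union> Y0)"
  proof (cases "can_reply m v0 n M B")
    case True
    then show ?thesis using that assms(3) unfolding can_reply_def by (meson le_trans)
  next
    case False
    then show ?thesis using that[of "{}"] by simp
  qed
  have "infinite (Z2_edges - (M \<union> B \<union> Y0))"
    using assms Y0(2) infinite_Z2_edges Diff_infinite_finite by blast
  then obtain Z where Z: "Z \<subseteq> Z2_edges - (M \<union> B \<union> Y0)" "finite Z" "card Z = b - card Y0"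
    by (meson infinite_arbitrarily_large)
  have "card (Y0 \<union> Z) = b" using Y0 Z by (subst card_Un_disjoint) auto
  moreover have "can_reply m v0 n M B \<longrightarrow> wins m v0 n M (B \<union> (Y0 \<union> Z))"
    using Y0(4) wins_mono_claimed[of m v0 n M "B \<union> Y0" "B \<union> (Y0 \<union> Z)"] by auto
  ultimately have "Y0 \<union> Z \<in> replies m b v0 n M B"
    using Y0 Z unfolding replies_def by blast
  then show ?thesis by blast
qed

text \<open>
  Breaker's edges after Maker's moves \<open>Xs\<close>, listed with the latest move first.
\<close>

fun claimed :: "nat \<Rightarrow> nat \<Rightarrow> vertex \<Rightarrow> nat \<Rightarrow> edge set list \<Rightarrow> edge set" where
  "claimed m b v0 n [] = {}"
| "claimed m b v0 n (X # Xs) = claimed m b v0 n Xs \<union>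
     (SOME Y. Y \<in> replies m b v0 (n - Suc (length Xs)) (X \<union> \<Union>(set Xs)) (claimed m b v0 n Xs))"

definition follow :: "nat \<Rightarrow> nat \<Rightarrow> vertex \<Rightarrow> nat \<Rightarrow> strategy" where
  "follow m b v0 n L = (SOME Y. Y \<in> replies m b v0 (n - length L) (\<Union>(set L))
     (claimed m b v0 n (tl (rev L))))"

lemma breaker_move_follow:
  "breaker_move (follow m b v0 n) M i = (SOME Y. Y \<in> replies m b v0 (n - Suc i)
     (maker_edges M (Suc i)) (claimed m b v0 n (rev (map M [0..<i]))))"
  by (simp add: breaker_move_def follow_def maker_edges_def lessThan_Suc atLeast0LessThan)

lemma breaker_edges_follow:
  "breaker_edges (follow m b v0 n) M i = claimed m b v0 n (rev (map M [0..<i]))"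
proof (induction i)
  case (Suc i)
  have "breaker_edges (follow m b v0 n) M (Suc i) =
      claimed m b v0 n (rev (map M [0..<i])) \<union> breaker_move (follow m b v0 n) M i"
    by (simp add: breaker_edges_def lessThan_Suc Un_commute flip: Suc.IH)
  then show ?case
    by (simp add: breaker_move_follow maker_edges_def lessThan_Suc atLeast0LessThan)
qed (simp add: breaker_edges_def)

text \<open>
  Breaker keeps the position won with one round less to go after each reply. Extra claims do no harm,
  so he can complete a winning reply to \<open>b\<close> edges.
\<close>

lemma wins_imp_breaker_wins_within:
  assumes "2 * m \<le> b" "wins m v0 n {} {}"
  shows "breaker_wins_within m b v0 n"
proof -
  let ?\<sigma> = "follow m b v0 n"
  have maker_Suc: "maker_edges M (Suc k) = maker_edges M k \<union> M k" for M k
    by (auto simp: maker_edges_def lessThan_Suc)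
  have breaker_Suc: "breaker_edges ?\<sigma> M (Suc k) = breaker_edges ?\<sigma> M k \<union> breaker_move ?\<sigma> M k" for M k
    by (auto simp: breaker_edges_def lessThan_Suc)
  have move: "breaker_move ?\<sigma> M k =
      (SOME Y. Y \<in> replies m b v0 (n - Suc k) (maker_edges M (Suc k)) (breaker_edges ?\<sigma> M k))" for M k
    by (simp only: breaker_edges_follow breaker_move_follow)
  have legal_finite: "finite (maker_edges M k) \<and> finite (breaker_edges ?\<sigma> M k)"
    if "\<forall>i<k. maker_legal m ?\<sigma> M i" for M k
    using that
  proof (induction k)
    case (Suc k)
    then have fin: "finite (maker_edges M k)" "finite (breaker_edges ?\<sigma> M k)" "finite (M k)"
      by (auto simp: maker_legal_def)
    then have "breaker_move ?\<sigma> M k \<in>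
        replies m b v0 (n - Suc k) (maker_edges M (Suc k)) (breaker_edges ?\<sigma> M k)"
      unfolding move maker_Suc by (intro some_in_eq[THEN iffD2] replies_nonempty) (use assms in auto)
    then show ?case using fin unfolding maker_Suc breaker_Suc by (auto simp: replies_def)
  qed (simp add: maker_edges_def breaker_edges_def)
  have move_in: "breaker_move ?\<sigma> M k \<in>
      replies m b v0 (n - Suc k) (maker_edges M (Suc k)) (breaker_edges ?\<sigma> M k)"
    if "\<forall>i\<le>k. maker_legal m ?\<sigma> M i" for M k
  proof -
    have "finite (maker_edges M k)" "finite (breaker_edges ?\<sigma> M k)" "finite (M k)"
      using that legal_finite[of k M] by (auto simp: maker_legal_def)
    then show ?thesis
      unfolding move maker_Suc by (intro some_in_eq[THEN iffD2] replies_nonempty) (use assms in auto)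
  qed
  then have "legal_strategy m b ?\<sigma>"
    unfolding legal_strategy_def breaker_legal_def replies_def by blast
  moreover have "breaker_has_won v0 (breaker_edges ?\<sigma> M n)" if "\<forall>i. maker_legal m ?\<sigma> M i" for M
  proof -
    have "wins m v0 (n - k) (maker_edges M k) (breaker_edges ?\<sigma> M k)" if "k \<le> n" for k
      using that
    proof (induction k)
      case 0
      then show ?case using assms by (simp add: maker_edges_def breaker_edges_def)
    next
      case (Suc k)
      let ?B = "breaker_edges ?\<sigma> M k"
      have n: "n - k = Suc (n - Suc k)" using Suc.prems by simp
      have w: "wins m v0 (Suc (n - Suc k)) (maker_edges M k) ?B" using Suc n by simp
      have l: "maker_legal m ?\<sigma> M k" using \<open>\<forall>i. maker_legal m ?\<sigma> M i\<close> by blast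
      show ?case
      proof (cases "sealed v0 ?B")
        case True
        then have "sealed v0 (breaker_edges ?\<sigma> M (Suc k))"
          using sealed_mono breaker_Suc by blast
        then show ?thesis by (rule sealed_imp_wins)
      next
        case False
        then have "can_reply m v0 (n - Suc k) (maker_edges M (Suc k)) ?B"
          using w l unfolding wins_Suc_iff maker_Suc maker_legal_def by blast
        then show ?thesis using move_in[of k M] \<open>\<forall>i. maker_legal m ?\<sigma> M i\<close>
          unfolding breaker_Suc replies_def by blast
      qed
    qed
    from this[of n] show ?thesis using sealed_imp_won by simp
  qed
  ultimately show ?thesis unfolding breaker_wins_within_def by blast
qed

section \<open>The potential of a region\<close>

definition star :: "vertex \<Rightarrow> edge set" where
  "star x = {e \<in> Z2_edges. x \<in> e}"

lemma Z2_edge_iff: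
  "{u, v} \<in> Z2_edges \<longleftrightarrow> \<bar>fst u - fst v\<bar> + \<bar>snd u - snd v\<bar> = 1"
proof
  assume "{u, v} \<in> Z2_edges"
  then obtain x y x' y' where "{u, v} = {(x, y), (x', y')}" "\<bar>x - x'\<bar> + \<bar>y - y'\<bar> = 1"
    unfolding Z2_edges_def by blast
  then show "\<bar>fst u - fst v\<bar> + \<bar>snd u - snd v\<bar> = 1"
    by (auto simp: doubleton_eq_iff abs_minus_commute)
next
  assume "\<bar>fst u - fst v\<bar> + \<bar>snd u - snd v\<bar> = 1"
  then show "{u, v} \<in> Z2_edges"
    unfolding Z2_edges_def by (cases u; cases v) auto
qed

lemma Z2_edgeE:
  assumes "e \<in> Z2_edges" "x \<in> e"
  obtains y where "e = {x, y}" "\<bar>fst x - fst y\<bar> + \<bar>snd x - snd y\<bar> = 1"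
proof -
  obtain u v where uv: "e = {u, v}" using assms(1) unfolding Z2_edges_def by blast
  then have "e = {x, if x = u then v else u}" using assms(2) by auto
  then show thesis using that assms(1) Z2_edge_iff by metis
qed

lemma neighbour_cases:
  fixes x y :: vertex
  assumes "\<bar>fst x - fst y\<bar> + \<bar>snd x - snd y\<bar> = 1"
  shows "y = (fst x + 1, snd x) \<or> y = (fst x - 1, snd x) \<or>
    y = (fst x, snd x + 1) \<or> y = (fst x, snd x - 1)"
  using assms unfolding prod_eq_iff fst_conv snd_conv by presburger

lemma star_eq:
  "star x = {{x, (fst x + 1, snd x)}, {x, (fst x - 1, snd x)},
     {x, (fst x, snd x + 1)}, {x, (fst x, snd x - 1)}}" (is "_ = ?R")
proof
  show "star x \<subseteq> ?R"
  proof
    fix e assume "e \<in> star x"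
    then obtain y where "e = {x, y}" "\<bar>fst x - fst y\<bar> + \<bar>snd x - snd y\<bar> = 1"
      unfolding star_def using Z2_edgeE by blast
    then show "e \<in> ?R" using neighbour_cases by blast
  qed
  show "?R \<subseteq> star x" unfolding star_def by (auto simp: Z2_edge_iff)
qed

lemma card_star: "card (star x) = 4"
  unfolding star_eq by (cases x) (simp add: doubleton_eq_iff)

lemma finite_star [simp]: "finite (star x)"
  unfolding star_eq by simp

lemma finite_edge_boundary: "finite S \<Longrightarrow> finite (edge_boundary S)"
  by (rule finite_subset[of _ "\<Union>(star ` S)"]) (force simp: edge_boundary_def star_def, simp)

lemma edge_boundary_subset: "edge_boundary S \<subseteq> Z2_edges"
  by (auto simp: edge_boundary_def)

text \<open>
  The unit square with lower left corner \<open>q\<close>.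
\<close>

definition square :: "vertex \<Rightarrow> vertex set" where
  "square q = {fst q, fst q + 1} \<times> {snd q, snd q + 1}"

definition square_edges :: "vertex \<Rightarrow> edge set" where
  "square_edges q = {e \<in> Z2_edges. e \<subseteq> square q}"

lemma card_star_square: "x \<in> square q \<Longrightarrow> card (star x \<inter> square_edges q) = 2"
proof -
  assume x: "x \<in> square q"
  obtain a b where q: "q = (a, b)" by (cases q)
  have "star x \<inter> square_edges q = star x \<inter> {e. e \<subseteq> square q}"
    by (auto simp: star_def square_edges_def)
  moreover have "x = (a, b) \<or> x = (a + 1, b) \<or> x = (a, b + 1) \<or> x = (a + 1, b + 1)"
    using x by (auto simp: square_def q)
  moreover have "card (star (a, b) \<inter> {e. e \<subseteq> square q}) = 2"
    "card (star (a + 1, b) \<inter> {e. e \<subseteq> square q}) = 2"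
    "card (star (a, b + 1) \<inter> {e. e \<subseteq> square q}) = 2"
    "card (star (a + 1, b + 1) \<inter> {e. e \<subseteq> square q}) = 2"
    unfolding star_eq square_def q by (simp_all add: Int_insert_left doubleton_eq_iff)
  ultimately show ?thesis by metis
qed

definition outside :: "edge set \<Rightarrow> vertex set \<Rightarrow> edge set" where
  "outside M S = {e \<in> M. \<not> e \<subseteq> S}"

definition gates :: "vertex set \<Rightarrow> edge set \<Rightarrow> vertex \<Rightarrow> edge set" where
  "gates S B q = edge_boundary S \<inter> square_edges q - B"

text \<open>
  Boundary edges on the tracked squares \<open>Qs\<close> are meant to stay open and cost nothing, as long as
  each square has at most two of them. A square has four gates exactly if \<open>S\<close>
  contains just two opposite corners of it; the last sum charges for this excess.
  For \<open>Qs = {}\<close> this is the plain potential.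
\<close>

definition potential :: "vertex set \<Rightarrow> edge set \<Rightarrow> edge set \<Rightarrow> vertex set \<Rightarrow> nat" where
  "potential Qs M B S = card (edge_boundary S - B - \<Union>(square_edges ` Qs)) +
     2 * card (outside M S) + (\<Sum>q\<in>Qs. card (gates S B q) - 2)"

definition position :: "edge set \<Rightarrow> edge set \<Rightarrow> bool" where
  "position M B \<longleftrightarrow> finite M \<and> M \<subseteq> Z2_edges \<and> M \<inter> B = {}"

definition disjoint_squares :: "vertex set \<Rightarrow> bool" where
  "disjoint_squares Qs \<longleftrightarrow> finite Qs \<and>
     (\<forall>q\<in>Qs. \<forall>q'\<in>Qs. q \<noteq> q' \<longrightarrow> square_edges q \<inter> square_edges q' = {})"

lemma potential_empty: "potential {} M B S = card (edge_boundary S - B) + 2 * card (outside M S)"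
  by (simp add: potential_def)

lemma card_outside_less:
  assumes "finite M" "e \<in> M" "e \<subseteq> S'" "\<not> e \<subseteq> S" "S \<subseteq> S'"
  shows "card (outside M S') + 1 \<le> card (outside M S)"
proof -
  have "outside M S' \<subseteq> outside M S - {e}" using assms by (auto simp: outside_def)
  then have "card (outside M S') \<le> card (outside M S - {e})"
    using assms(1) by (intro card_mono) (auto simp: outside_def)
  moreover have "card (outside M S - {e}) + 1 = card (outside M S)"
    using card_Suc_Diff1[of "outside M S" e] assms by (simp add: outside_def)
  ultimately show ?thesis by linarith
qed

text \<open>
  Let \<open>k\<close> tracked squares contain \<open>x\<close>. They are edge-disjoint and each has two edges at \<open>x\<close>, so \<open>4 - 2 * k\<close>
  edges at \<open>x\<close> are untracked. A tracked square at \<open>x\<close> gains at most two gates, and none if \<open>e\<close> is one of its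
  edges. If \<open>e\<close> is untracked, the boundary cost changes by at most \<open>2 - 2 * k\<close> and the excess by at
  most \<open>2 * k\<close>; if \<open>e\<close> is tracked, by \<open>4 - 2 * k\<close> and \<open>2 * k - 2\<close>. Either way the total of 2 is paid for by \<open>e\<close>,
  which moves inside.
\<close>

lemma potential_insert_le:
  assumes pos: "position M B" and Qs: "disjoint_squares Qs" and S: "finite S"
    and e: "e \<in> M" "e \<inter> S \<noteq> {}" "x \<in> e" "x \<notin> S"
  shows "potential Qs M B (insert x S) \<le> potential Qs M B S"
proof -
  let ?S = "insert x S" and ?T = "\<Union>(square_edges ` Qs)"
  let ?Qx = "{q \<in> Qs. x \<in> square q}"
  have fin: "finite M" "finite Qs" "finite ?Qx" "finite (edge_boundary S)"
    using pos Qs S finite_edge_boundary by (auto simp: position_def disjoint_squares_def)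
  have eE: "e \<in> Z2_edges" "e \<notin> B" using pos e by (auto simp: position_def)
  have e_star: "e \<in> star x" using eE e by (simp add: star_def)
  obtain y where "e = {x, y}" using Z2_edgeE[OF eE(1) e(3)] by blast
  then have e_sub: "e \<subseteq> ?S" using e by auto
  have e_bd: "e \<in> edge_boundary S" using e eE by (auto simp: edge_boundary_def)
  have bd: "edge_boundary ?S \<subseteq> (edge_boundary S - {e}) \<union> (star x - {e})"
    using e_sub by (auto simp: edge_boundary_def star_def)
  have out: "card (outside M ?S) + 1 \<le> card (outside M S)"
    using card_outside_less[OF fin(1) e(1) e_sub] e by blast
  have "star x \<inter> ?T = (\<Union>q\<in>?Qx. star x \<inter> square_edges q)"
    by (auto simp: star_def square_edges_def)
  also have "card \<dots> = (\<Sum>q\<in>?Qx. card (star x \<inter> square_edges q))"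
  proof (rule card_UN_disjoint[OF fin(3)])
    show "\<forall>q\<in>?Qx. finite (star x \<inter> square_edges q)" by simp
    show "\<forall>q\<in>?Qx. \<forall>q'\<in>?Qx. q \<noteq> q' \<longrightarrow>
        star x \<inter> square_edges q \<inter> (star x \<inter> square_edges q') = {}"
      using Qs unfolding disjoint_squares_def by blast
  qed
  also have "\<dots> = 2 * card ?Qx" using card_star_square by simp
  finally have cT: "card (star x \<inter> ?T) = 2 * card ?Qx" .
  have cost_T: "card (star x - ?T) + 2 * card ?Qx = 4"
    using card_Diff_subset_Int[of "star x" ?T] cT card_star[of x]
      card_mono[of "star x" "star x \<inter> ?T"] by simp
  have cost: "card (edge_boundary ?S - B - ?T) \<le>
      card (edge_boundary S - B - ?T - {e}) + card (star x - ?T - {e})"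
  proof -
    have "edge_boundary ?S - B - ?T \<subseteq> (edge_boundary S - B - ?T - {e}) \<union> (star x - ?T - {e})"
      using bd by blast
    then have "card (edge_boundary ?S - B - ?T) \<le>
        card ((edge_boundary S - B - ?T - {e}) \<union> (star x - ?T - {e}))"
      using fin by (intro card_mono) auto
    then show ?thesis using card_Un_le le_trans by blast
  qed
  have gate: "card (gates ?S B q) - 2 \<le>
      card (gates S B q) - 2 + (if q \<in> ?Qx \<and> e \<notin> square_edges q then 2 else 0)"
    if "q \<in> Qs" for q
  proof (cases "x \<in> square q")
    case False
    then have "gates ?S B q \<subseteq> gates S B q"
      using bd by (auto simp: gates_def square_edges_def star_def)
    then have "card (gates ?S B q) \<le> card (gates S B q)"
      using fin by (intro card_mono) (auto simp: gates_def)
    then show ?thesis by simp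
  next
    case True
    have "gates ?S B q \<subseteq> (gates S B q - {e}) \<union> (star x \<inter> square_edges q - {e})"
      using bd by (auto simp: gates_def)
    then have "card (gates ?S B q) \<le> card ((gates S B q - {e}) \<union> (star x \<inter> square_edges q - {e}))"
      using fin by (intro card_mono) (auto simp: gates_def)
    then have *: "card (gates ?S B q) \<le> card (gates S B q - {e}) + card (star x \<inter> square_edges q - {e})"
      using card_Un_le le_trans by blast
    show ?thesis
    proof (cases "e \<in> square_edges q")
      case e_q: True
      then have "e \<in> gates S B q" using e_bd eE by (simp add: gates_def)
      then have "card (gates S B q - {e}) + 1 = card (gates S B q)"
        using fin card_Suc_Diff1[of "gates S B q" e] by (simp add: gates_def)
      moreover have "card (star x \<inter> square_edges q - {e}) = 1"
        using card_star_square[OF True] e_star e_q by simp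
      ultimately show ?thesis using * by simp
    next
      case False
      then show ?thesis
        using * card_star_square[OF True] True that
          card_mono[of "gates S B q" "gates S B q - {e}"] fin by (simp add: gates_def)
    qed
  qed
  let ?Qe = "{q \<in> ?Qx. e \<notin> square_edges q}"
  have "(\<Sum>q\<in>Qs. card (gates ?S B q) - 2) \<le> (\<Sum>q\<in>Qs. card (gates S B q) - 2 +
      (if q \<in> ?Qx \<and> e \<notin> square_edges q then 2 else 0))"
    by (rule sum_mono) (rule gate)
  also have "\<dots> = (\<Sum>q\<in>Qs. card (gates S B q) - 2) + 2 * card ?Qe"
  proof -
    have "(\<Sum>q\<in>Qs. if q \<in> ?Qx \<and> e \<notin> square_edges q then 2 else 0) = (\<Sum>q\<in>?Qe. 2::nat)"
      using fin by (intro sum.mono_neutral_cong_right) auto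
    then show ?thesis by (simp add: sum.distrib)
  qed
  finally have sums: "(\<Sum>q\<in>Qs. card (gates ?S B q) - 2) \<le>
      (\<Sum>q\<in>Qs. card (gates S B q) - 2) + 2 * card ?Qe" .
  show ?thesis
  proof (cases "e \<in> ?T")
    case False
    have "card (edge_boundary S - B - ?T - {e}) + 1 = card (edge_boundary S - B - ?T)"
      using False e_bd eE fin card_Suc_Diff1[of "edge_boundary S - B - ?T" e] by simp
    moreover have "card (star x - ?T - {e}) + 1 = card (star x - ?T)"
      using False e_star card_Suc_Diff1[of "star x - ?T" e] by simp
    moreover have "card ?Qe \<le> card ?Qx" using fin by (intro card_mono) auto
    ultimately show ?thesis using cost cost_T sums out unfolding potential_def by linarith
  next
    case True
    then obtain q where q: "q \<in> Qs" "e \<in> square_edges q" by blast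
    then have "q \<in> ?Qx - ?Qe" using e by (auto simp: square_edges_def)
    then have "card ?Qe < card ?Qx" using fin by (intro psubset_card_mono) auto
    moreover have "edge_boundary S - B - ?T - {e} = edge_boundary S - B - ?T" "star x - ?T - {e} = star x - ?T"
      using True by auto
    ultimately show ?thesis using cost cost_T sums out unfolding potential_def by simp
  qed
qed

lemma closed_region_exists:
  assumes pos: "position M B" and Qs: "disjoint_squares Qs" and S: "finite S"
  shows "\<exists>S'. finite S' \<and> S \<subseteq> S' \<and> edge_boundary S' \<inter> M = {} \<and>
    potential Qs M B S' \<le> potential Qs M B S"
  using S
proof (induction "card (outside M S)" arbitrary: S rule: less_induct)
  case less
  show ?case
  proof (cases "edge_boundary S \<inter> M = {}")
    case True
    then show ?thesis using less.prems by blast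
  next
    case False
    then obtain e where e: "e \<in> M" "e \<in> Z2_edges" "e \<inter> S \<noteq> {}" "\<not> e \<subseteq> S"
      by (auto simp: edge_boundary_def)
    then obtain x where x: "x \<in> e" "x \<notin> S" by blast
    obtain y where "e = {x, y}" using Z2_edgeE[OF e(2) x(1)] by blast
    then have "e \<subseteq> insert x S" using e x by auto
    then have "card (outside M (insert x S)) < card (outside M S)"
      using card_outside_less[of M e "insert x S" S] pos e subset_insertI[of S x]
      by (simp add: position_def)
    from less.hyps[OF this] less.prems obtain S' where S': "finite S'" "insert x S \<subseteq> S'"
        "edge_boundary S' \<inter> M = {}" "potential Qs M B S' \<le> potential Qs M B (insert x S)"
      by auto
    moreover have "potential Qs M B (insert x S) \<le> potential Qs M B S"
      using potential_insert_le[OF pos Qs less.prems] e x by blast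
    ultimately show ?thesis by (meson insert_subset le_trans)
  qed
qed

lemma position_add:
  "position M B \<Longrightarrow> X \<subseteq> Z2_edges - (M \<union> B) \<Longrightarrow> finite X \<Longrightarrow> position (M \<union> X) B"
  by (auto simp: position_def)

lemma card_outside_Un:
  assumes "finite M" "finite X"
  shows "card (outside (M \<union> X) S) \<le> card (outside M S) + card X"
proof -
  have "outside (M \<union> X) S \<subseteq> outside M S \<union> X" by (auto simp: outside_def)
  then have "card (outside (M \<union> X) S) \<le> card (outside M S \<union> X)"
    using assms by (intro card_mono) (auto simp: outside_def)
  then show ?thesis using card_Un_le le_trans by blast
qed

lemma card_le_union3:
  assumes "D \<subseteq> A1 \<union> A2 \<union> A3" "finite A1" "finite A2" "finite A3"
  shows "card D \<le> card A1 + card A2 + card A3"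
proof -
  have "card D \<le> card (A1 \<union> A2 \<union> A3)" using assms by (intro card_mono) auto
  also have "\<dots> \<le> card A1 + card A2 + card A3"
    by (meson card_Un_le add_le_mono1 le_trans)
  finally show ?thesis .
qed

lemma can_reply_keeping:
  assumes "finite S" "edge_boundary S \<inter> M = {}"
    and "card (edge_boundary S - B - K) \<le> 2 * m"
    and "wins m v0 n M (B \<union> (edge_boundary S - K))"
  shows "can_reply m v0 n M B"
proof -
  let ?Y = "edge_boundary S - B - K"
  have "B \<union> ?Y = B \<union> (edge_boundary S - K)" by blast
  moreover have "?Y \<subseteq> Z2_edges - (M \<union> B)" using assms(2) edge_boundary_subset by blast
  ultimately show ?thesis
    unfolding can_reply_def using assms finite_edge_boundary by (metis finite_Diff)
qed

lemma can_reply_sealing: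
  assumes "finite S" "v0 \<in> S" "edge_boundary S \<inter> M = {}" "card (edge_boundary S - B) \<le> 2 * m"
  shows "can_reply m v0 n M B"
proof (rule can_reply_keeping[of S M B "{}"])
  show "wins m v0 n M (B \<union> (edge_boundary S - {}))"
    by (rule sealed_imp_wins) (use assms in \<open>auto simp: sealed_def\<close>)
qed (use assms in auto)

lemma can_reply_if_potential_small:
  assumes "position M B" "finite S" "v0 \<in> S" "potential {} M B S \<le> 2 * m"
  shows "can_reply m v0 n M B"
proof -
  obtain S' where S': "finite S'" "S \<subseteq> S'" "edge_boundary S' \<inter> M = {}"
      "potential {} M B S' \<le> potential {} M B S"
    using closed_region_exists[OF assms(1) _ assms(2), of "{}"] by (auto simp: disjoint_squares_def)
  show ?thesis
    by (rule can_reply_sealing[of S']) (use S' assms in \<open>auto simp: potential_def\<close>)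
qed

section \<open>Two guarded squares\<close>

text \<open>
  The situation that Breaker restores after each of his moves.
\<close>

definition guarded :: "vertex \<Rightarrow> vertex set \<Rightarrow> edge set \<Rightarrow> edge set \<Rightarrow> vertex set \<Rightarrow> bool" where
  "guarded v0 Qs M B S \<longleftrightarrow> position M B \<and> finite S \<and> v0 \<in> S \<and> edge_boundary S \<inter> M = {} \<and>
     edge_boundary S - B \<subseteq> \<Union>(square_edges ` Qs) \<and> (\<forall>q\<in>Qs. card (gates S B q) \<le> 2)"

definition rank :: "vertex \<Rightarrow> vertex set \<Rightarrow> nat" where
  "rank q S = card (square q - S)"

lemma finite_square [simp]: "finite (square q)"
  by (simp add: square_def)

lemma card_square: "card (square q) = 4"
  unfolding square_def card_cartesian_product by simp

lemma finite_gates: "finite S \<Longrightarrow> finite (gates S B q)"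
  by (simp add: gates_def finite_edge_boundary)

lemma rank_mono: "S \<subseteq> S' \<Longrightarrow> rank q S' \<le> rank q S"
  unfolding rank_def by (rule card_mono) auto

lemma rank_less: "S \<subseteq> S' \<Longrightarrow> x \<in> square q \<Longrightarrow> x \<in> S' \<Longrightarrow> x \<notin> S \<Longrightarrow> rank q S' < rank q S"
  unfolding rank_def by (rule psubset_card_mono) auto

lemma rank_0_imp_sealed:
  assumes "guarded v0 Qs M B S" "\<forall>q\<in>Qs. rank q S = 0"
  shows "sealed v0 B"
proof -
  have "square q \<subseteq> S" if "q \<in> Qs" for q
    using assms(2) that by (auto simp: rank_def)
  then have "edge_boundary S \<inter> \<Union>(square_edges ` Qs) = {}"
    by (fastforce simp: edge_boundary_def square_edges_def)
  moreover have S: "finite S" "v0 \<in> S" "edge_boundary S - B \<subseteq> \<Union>(square_edges ` Qs)"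
    using assms(1) unfolding guarded_def by simp_all
  ultimately have "edge_boundary S \<subseteq> B" by blast
  then show ?thesis using S(1,2) unfolding sealed_def by blast
qed

text \<open>
  The square that shares only the vertex \<open>x\<close> with the square \<open>q\<close>; together they contain all four edges
  at \<open>x\<close>.
\<close>

definition opposite :: "vertex \<Rightarrow> vertex \<Rightarrow> vertex" where
  "opposite q x = (2 * fst x - fst q - 1, 2 * snd x - snd q - 1)"

lemma opposite_square:
  assumes "x \<in> square q"
  shows "x \<in> square (opposite q x)" "square_edges q \<inter> square_edges (opposite q x) = {}"
    "opposite q x \<noteq> q" "star x \<subseteq> square_edges q \<union> square_edges (opposite q x)"
proof -
  obtain a b c d where q: "q = (a, b)" "x = (c, d)" by (cases q; cases x)
  have cd: "c = a \<or> c = a + 1" "d = b \<or> d = b + 1" using assms by (auto simp: square_def q)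
  show x: "x \<in> square (opposite q x)" using cd by (auto simp: square_def opposite_def q)
  have sub: "square q \<inter> square (opposite q x) \<subseteq> {x}"
    using cd by (auto simp: square_def opposite_def q)
  have "\<not> e \<subseteq> {x}" if "e \<in> Z2_edges" for e
    using that by (force simp: Z2_edges_def)
  then show disj: "square_edges q \<inter> square_edges (opposite q x) = {}"
    using sub by (auto simp: square_edges_def)
  show "opposite q x \<noteq> q" by (simp add: opposite_def q) presburger
  have "star x \<inter> (square_edges q \<union> square_edges (opposite q x)) = star x"
  proof (rule card_seteq)
    have "card (star x \<inter> (square_edges q \<union> square_edges (opposite q x))) =
        card (star x \<inter> square_edges q) + card (star x \<inter> square_edges (opposite q x))"
      unfolding Int_Un_distrib using disj by (intro card_Un_disjoint) auto
    then show "card (star x) \<le> card (star x \<inter> (square_edges q \<union> square_edges (opposite q x)))"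
      using card_star card_star_square assms x by simp
  qed auto
  then show "star x \<subseteq> square_edges q \<union> square_edges (opposite q x)" by blast
qed

text \<open>
  Breaker claims what is open off the squares and the excess gates. A Maker edge outside \<open>S\<close> lowers the
  bound on these by two, which is enough to shut one of the squares completely, and two such edges allow
  him to seal \<open>S\<close>. When one square has to go, he keeps the one that is closer to being swallowed.
\<close>

lemma two_square_reply:
  assumes pos: "position M B" and S: "finite S" "v0 \<in> S" "edge_boundary S \<inter> M = {}"
    and q: "q1 \<noteq> q2" "disjoint_squares {q1, q2}"
    and pot: "potential {q1, q2} M B S \<le> 2 * m"
    and both: "\<And>B'. outside M S = {} \<Longrightarrow> guarded v0 {q1, q2} M B' S \<Longrightarrow> wins m v0 n M B'"
    and one: "\<And>B' q. card (outside M S) = 1 \<Longrightarrow> guarded v0 {q} M B' S \<Longrightarrow>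
      rank q S = min (rank q1 S) (rank q2 S) \<Longrightarrow> wins m v0 n M B'"
  shows "can_reply m v0 n M B"
proof -
  let ?T = "square_edges q1 \<union> square_edges q2" and ?bd = "edge_boundary S"
  have disj: "square_edges q1 \<inter> square_edges q2 = {}"
    using q by (simp add: disjoint_squares_def)
  have P: "card (?bd - B - ?T) + 2 * card (outside M S) +
      (card (gates S B q1) - 2 + (card (gates S B q2) - 2)) \<le> 2 * m"
    using pot q(1) by (simp add: potential_def)
  have finS: "finite ?bd" "finite (gates S B q)" for q
    using S finite_edge_boundary finite_gates by auto
  have fin_out: "finite (outside M S)" using pos by (simp add: position_def outside_def)
  have keep: "\<exists>K. K \<subseteq> gates S B q \<and> card K \<le> 2 \<and> card (gates S B q - K) = card (gates S B q) - 2" for q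
  proof -
    obtain K where "K \<subseteq> gates S B q" "card K = min 2 (card (gates S B q))"
      by (rule obtain_subset_with_card_n[OF min.cobounded2])
    moreover from this have "card (gates S B q - K) = card (gates S B q) - card K"
      using finS(2)[of q] card_Diff_subset[of K "gates S B q"] finite_subset by blast
    ultimately show ?thesis by (intro exI[of _ K]) auto
  qed
  consider "card (outside M S) = 0" | "card (outside M S) = 1" | "card (outside M S) \<ge> 2" by linarith
  then show ?thesis
  proof cases
    case 1
    obtain K1 where K1: "K1 \<subseteq> gates S B q1" "card K1 \<le> 2"
        "card (gates S B q1 - K1) = card (gates S B q1) - 2" using keep by blast
    obtain K2 where K2: "K2 \<subseteq> gates S B q2" "card K2 \<le> 2"
        "card (gates S B q2 - K2) = card (gates S B q2) - 2" using keep by blast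
    let ?K = "K1 \<union> K2"
    have "card (?bd - B - ?K) \<le>
        card (?bd - B - ?T) + card (gates S B q1 - K1) + card (gates S B q2 - K2)"
      by (rule card_le_union3) (use finS in \<open>auto simp: gates_def\<close>)
    then have c: "card (?bd - B - ?K) \<le> 2 * m" using P K1 K2 by linarith
    let ?B = "B \<union> (?bd - ?K)"
    have "gates S ?B q1 \<subseteq> K1" "gates S ?B q2 \<subseteq> K2"
      using K1(1) K2(1) disj by (auto simp: gates_def)
    then have "card (gates S ?B q1) \<le> card K1" "card (gates S ?B q2) \<le> card K2"
      using finS K1(1) K2(1) by (meson card_mono finite_subset)+
    moreover have "position M ?B" "?bd - ?B \<subseteq> ?T"
      using pos S K1(1) K2(1) by (auto simp: position_def gates_def)
    ultimately have "guarded v0 {q1, q2} M ?B S"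
      using S K1(2) K2(2) by (simp add: guarded_def)
    moreover have "outside M S = {}" using 1 fin_out by simp
    ultimately show ?thesis using can_reply_keeping[OF S(1,3) c] both by blast
  next
    case 2
    obtain q q' where qq': "q = q1 \<and> q' = q2 \<or> q = q2 \<and> q' = q1"
        and qq: "rank q S = min (rank q1 S) (rank q2 S)"
      by (metis min_def)
    obtain K where K: "K \<subseteq> gates S B q" "card K \<le> 2"
        "card (gates S B q - K) = card (gates S B q) - 2" using keep by blast
    have "card (?bd - B - K) \<le> card (?bd - B - ?T) + card (gates S B q - K) + card (gates S B q')"
      by (rule card_le_union3) (use finS qq' in \<open>auto simp: gates_def\<close>)
    then have c: "card (?bd - B - K) \<le> 2 * m" using P K 2 qq' by auto
    let ?B = "B \<union> (?bd - K)"
    have "gates S ?B q \<subseteq> K" by (auto simp: gates_def)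
    then have "card (gates S ?B q) \<le> card K"
      using finS K(1) by (meson card_mono finite_subset)
    moreover have "position M ?B" "?bd - ?B \<subseteq> square_edges q"
      using pos S K(1) by (auto simp: position_def gates_def)
    ultimately have "guarded v0 {q} M ?B S"
      using S K(2) by (simp add: guarded_def)
    then show ?thesis using can_reply_keeping[OF S(1,3) c] one 2 qq by blast
  next
    case 3
    have "card (?bd - B) \<le> card (?bd - B - ?T) + card (gates S B q1) + card (gates S B q2)"
      by (rule card_le_union3) (use finS in \<open>auto simp: gates_def\<close>)
    then have "card (?bd - B) \<le> 2 * m" using P 3 by linarith
    then show ?thesis using can_reply_sealing S by blast
  qed
qed

lemma guarded_crossing:
  assumes "guarded v0 Qs M B S" "position M' B" "edge_boundary S \<inter> M' \<noteq> {}"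
  obtains f x q where "f \<in> M'" "f \<in> edge_boundary S" "f \<notin> B" "q \<in> Qs" "f \<in> square_edges q"
    "x \<in> f" "x \<notin> S" "x \<in> square q" "f \<subseteq> insert x S"
proof -
  obtain f where f: "f \<in> M'" "f \<in> edge_boundary S" using assms(3) by blast
  then have "f \<notin> B" using assms(2) by (auto simp: position_def)
  then obtain q where q: "q \<in> Qs" "f \<in> square_edges q"
    using assms(1) f by (auto simp: guarded_def)
  obtain x where x: "x \<in> f" "x \<notin> S" using f by (auto simp: edge_boundary_def)
  obtain y where "f = {x, y}" using Z2_edgeE[of f x] f x edge_boundary_subset by blast
  then have "f \<subseteq> insert x S" using f x by (auto simp: edge_boundary_def)
  moreover have "x \<in> square q" using q x by (auto simp: square_edges_def)
  ultimately show thesis using that f \<open>f \<notin> B\<close> q x by blast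
qed

lemma card_guarded_boundary:
  assumes "guarded v0 Qs M B S" "finite Qs"
  shows "card (edge_boundary S - B) \<le> 2 * card Qs"
proof -
  have "edge_boundary S - B \<subseteq> (\<Union>q\<in>Qs. gates S B q)"
    using assms by (auto simp: guarded_def gates_def)
  moreover have "finite (\<Union>q\<in>Qs. gates S B q)"
    using assms finite_gates by (auto simp: guarded_def)
  ultimately have "card (edge_boundary S - B) \<le> card (\<Union>q\<in>Qs. gates S B q)"
    by (rule card_mono[rotated])
  also have "\<dots> \<le> (\<Sum>q\<in>Qs. card (gates S B q))" by (rule card_UN_le[OF assms(2)])
  also have "\<dots> \<le> (\<Sum>q\<in>Qs. 2)" by (rule sum_mono) (use assms in \<open>auto simp: guarded_def\<close>)
  finally show ?thesis by simp
qed

text \<open>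
  With two squares and no Maker edge outside, every crossing lowers the sum of the ranks, and after
  a move without crossing Breaker can seal the region or keep a square of minimal rank. With one square and perhaps one Maker edge outside,
  a crossing at \<open>x\<close> lowers its rank, and the opposite square at \<open>x\<close> is a new second square: all
  edges at \<open>x\<close> are then tracked, so the potential falls by two, which compensates for the edge that
  was outside. The bounds \<open>3 * min r1 r2 + r1 + r2\<close> and \<open>5 * r - 1\<close> on the numbers of rounds fit together
  because a new square has rank at most 3.
\<close>

lemma guarded_squares_win:
  assumes m: "1 \<le> m"
  shows "(\<forall>M B S q1 q2. q1 \<noteq> q2 \<longrightarrow> disjoint_squares {q1, q2} \<longrightarrow> guarded v0 {q1, q2} M B S \<longrightarrow>
      outside M S = {} \<longrightarrow> 3 * min (rank q1 S) (rank q2 S) + rank q1 S + rank q2 S \<le> N \<longrightarrow>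
      wins m v0 N M B) \<and>
    (\<forall>M B S q. guarded v0 {q} M B S \<longrightarrow> card (outside M S) \<le> 1 \<longrightarrow> 5 * rank q S \<le> N + 1 \<longrightarrow>
      wins m v0 N M B)"
proof (induction N)
  case 0
  show ?case by (auto simp: rank_0_imp_sealed)
next
  case (Suc N)
  have both_IH: "wins m v0 N M B"
    if "q1 \<noteq> q2" "disjoint_squares {q1, q2}" "guarded v0 {q1, q2} M B S" "outside M S = {}"
      "3 * min (rank q1 S) (rank q2 S) + rank q1 S + rank q2 S \<le> N" for M B S q1 q2
    using Suc.IH that by blast
  have one_IH: "wins m v0 N M B"
    if "guarded v0 {q} M B S" "card (outside M S) \<le> 1" "5 * rank q S \<le> N + 1" for M B S q
    using Suc.IH that by blast
  show ?case
  proof (intro conjI allI impI)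
    fix M B S q1 q2
    assume q: "q1 \<noteq> q2" "disjoint_squares {q1, q2}" and g: "guarded v0 {q1, q2} M B S"
      and out: "outside M S = {}"
      and N: "3 * min (rank q1 S) (rank q2 S) + rank q1 S + rank q2 S \<le> Suc N"
    have pos: "position M B" and S: "finite S" "v0 \<in> S" using g by (auto simp: guarded_def)
    have "can_reply m v0 N (M \<union> X) B"
      if X: "X \<subseteq> Z2_edges - (M \<union> B)" "finite X" "card X = m" for X
    proof -
      let ?M = "M \<union> X"
      have pos': "position ?M B" using position_add pos X by blast
      have out': "card (outside ?M S) \<le> m"
        using card_outside_Un[of M X S] pos X out by (simp add: position_def)
      show ?thesis
      proof (cases "edge_boundary S \<inter> ?M = {}")
        case True
        show ?thesis
        proof (cases "m = 1")
          case False
          then have "card (edge_boundary S - B) \<le> 2 * m"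
            using card_guarded_boundary[OF g] m card_insert_le_m1[of 2 "{q2}" q1] by auto
          then show ?thesis using can_reply_sealing S True by blast
        next
          case 1: True
          \<comment> \<open>Maker has wasted her only edge. Two claims do not seal four gates, but they shut one square.\<close>
          obtain q q' where "q = q1 \<and> q' = q2 \<or> q = q2 \<and> q' = q1"
              and r: "rank q S = min (rank q1 S) (rank q2 S)"
            by (metis min_def)
          then have qq: "{q, q'} = {q1, q2}" by blast
          let ?K = "gates S B q"
          let ?B = "B \<union> (edge_boundary S - ?K)"
          have "edge_boundary S - B - ?K \<subseteq> gates S B q'"
          proof
            fix f assume f: "f \<in> edge_boundary S - B - ?K"
            then have "f \<in> \<Union>(square_edges ` {q, q'})" using g qq by (auto simp: guarded_def)
            then show "f \<in> gates S B q'" using f by (auto simp: gates_def)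
          qed
          then have "card (edge_boundary S - B - ?K) \<le> card (gates S B q')"
            using finite_gates[OF S(1)] by (rule card_mono[rotated])
          moreover have "q \<in> {q1, q2}" "q' \<in> {q1, q2}" using qq by blast+
          then have c2: "card (gates S B q') \<le> 2" "card (gates S B q) \<le> 2"
            using g unfolding guarded_def by blast+
          ultimately have c: "card (edge_boundary S - B - ?K) \<le> 2 * m" using 1 by linarith
          have "gates S ?B q \<subseteq> gates S B q" by (auto simp: gates_def)
          then have "card (gates S ?B q) \<le> card (gates S B q)"
            using finite_gates[OF S(1)] by (rule card_mono[rotated])
          moreover have "position ?M ?B" using pos' True by (auto simp: position_def)
          moreover have "edge_boundary S - ?B \<subseteq> square_edges q" by (auto simp: gates_def)
          ultimately have "guarded v0 {q} ?M ?B S"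
            using S True c2 by (simp add: guarded_def)
          then have "wins m v0 N ?M ?B"
            by (rule one_IH) (use out' 1 N r in auto)
          then show ?thesis using can_reply_keeping[OF S(1) True c] by blast
        qed
      next
        case False
        obtain S' where S': "finite S'" "S \<subseteq> S'" "edge_boundary S' \<inter> ?M = {}"
            "potential {q1, q2} ?M B S' \<le> potential {q1, q2} ?M B S"
          using closed_region_exists[OF pos' q(2) S(1)] by blast
        have covered: "edge_boundary S - B - \<Union>(square_edges ` {q1, q2}) = {}"
          using g by (auto simp: guarded_def)
        have "card (gates S B q1) \<le> 2" "card (gates S B q2) \<le> 2"
          using g by (auto simp: guarded_def)
        then have "potential {q1, q2} ?M B S \<le> 2 * m"
          unfolding potential_def covered using out' q(1) by simp
        then have pot: "potential {q1, q2} ?M B S' \<le> 2 * m" using S'(4) by linarith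
        obtain f x q where f: "f \<in> ?M" "f \<in> edge_boundary S" "q \<in> {q1, q2}"
            "x \<in> f" "x \<notin> S" "x \<in> square q"
          using guarded_crossing[OF g pos' False] by metis
        have "f \<subseteq> S'" using f(1,2) S'(2,3) by (auto simp: edge_boundary_def)
        then have "rank q S' < rank q S" using rank_less[OF S'(2)] f by blast
        then have r: "rank q1 S' \<le> rank q1 S" "rank q2 S' \<le> rank q2 S"
            "rank q1 S' < rank q1 S \<or> rank q2 S' < rank q2 S"
          using rank_mono[OF S'(2)] f(3) by auto
        show ?thesis
        proof (rule two_square_reply[OF pos' S'(1) _ S'(3) q pot])
          show "v0 \<in> S'" using S S' by blast
          show "wins m v0 N ?M B'" if "outside ?M S' = {}" "guarded v0 {q1, q2} ?M B' S'" for B'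
            by (rule both_IH[OF q that(2,1)]) (use r N in linarith)
          show "wins m v0 N ?M B'" if "card (outside ?M S') = 1" "guarded v0 {q} ?M B' S'"
              "rank q S' = min (rank q1 S') (rank q2 S')" for B' q
            by (rule one_IH[OF that(2)]) (use that r N in linarith)+
        qed
      qed
    qed
    then show "wins m v0 (Suc N) M B" unfolding wins_Suc_iff by blast
  next
    fix M B S q
    assume g: "guarded v0 {q} M B S" and out: "card (outside M S) \<le> 1"
      and N: "5 * rank q S \<le> Suc N + 1"
    have pos: "position M B" and S: "finite S" "v0 \<in> S" using g by (auto simp: guarded_def)
    have "can_reply m v0 N (M \<union> X) B"
      if X: "X \<subseteq> Z2_edges - (M \<union> B)" "finite X" "card X = m" for X
    proof -
      let ?M = "M \<union> X"
      have pos': "position ?M B" using position_add pos X by blast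
      have out': "card (outside ?M S) \<le> m + 1"
        using card_outside_Un[of M X S] pos X out by (simp add: position_def)
      show ?thesis
      proof (cases "edge_boundary S \<inter> ?M = {}")
        case True
        have "card (edge_boundary S - B) \<le> 2 * m" using card_guarded_boundary[OF g] m by simp
        then show ?thesis using can_reply_sealing S True by blast
      next
        case False
        obtain f x where f: "f \<in> ?M" "f \<in> edge_boundary S" "f \<notin> B" "f \<in> square_edges q"
            "x \<in> f" "x \<notin> S" "x \<in> square q" "f \<subseteq> insert x S"
          using guarded_crossing[OF g pos' False] by (metis singletonD)
        let ?q = "opposite q x" and ?S = "insert x S"
        note opp = opposite_square[OF f(7)]
        have q: "q \<noteq> ?q" "disjoint_squares {q, ?q}"
          using opp by (auto simp: disjoint_squares_def Int_commute)
        have bd: "edge_boundary ?S \<subseteq> (edge_boundary S - {f}) \<union> (star x - {f})"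
          using f(8) by (auto simp: edge_boundary_def star_def)
        have guard: "edge_boundary S - B \<subseteq> square_edges q" "card (gates S B q) \<le> 2"
          using g by (auto simp: guarded_def)
        \<comment> \<open>The first vertex entered is absorbed by hand, the closure takes care of the rest.\<close>
        have covered: "edge_boundary ?S - B - \<Union>(square_edges ` {q, ?q}) = {}"
          using bd guard(1) opp(4) by blast
        have "card (outside ?M ?S) \<le> m"
        proof -
          have "finite ?M" "\<not> f \<subseteq> S" using pos' f(5,6) unfolding position_def by blast+
          then show ?thesis using card_outside_less[of ?M f ?S S] f(1,8) out' subset_insertI[of S x] by linarith
        qed
        moreover have "card (gates ?S B ?q) \<le> 2"
        proof -
          have "gates ?S B ?q \<subseteq> star x \<inter> square_edges ?q"
            using bd guard(1) opp(2) by (auto simp: gates_def)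
          then show ?thesis using card_mono[of "star x \<inter> square_edges ?q"] card_star_square[OF opp(1)] by auto
        qed
        moreover have "card (gates ?S B q) \<le> 2"
        proof -
          have "gates ?S B q \<subseteq> (gates S B q - {f}) \<union> (star x \<inter> square_edges q - {f})"
            using bd by (auto simp: gates_def)
          then have "card (gates ?S B q) \<le> card ((gates S B q - {f}) \<union> (star x \<inter> square_edges q - {f}))"
            using finite_gates[OF S(1)] by (intro card_mono) auto
          also have "\<dots> \<le> card (gates S B q - {f}) + card (star x \<inter> square_edges q - {f})"
            by (rule card_Un_le)
          also have "card (star x \<inter> square_edges q - {f}) = 1"
            using card_star_square[OF f(7)] f by (simp add: star_def square_edges_def)
          also have "card (gates S B q - {f}) \<le> 1"
            using guard(2) f finite_gates[OF S(1)] by (simp add: gates_def)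
          finally show ?thesis by simp
        qed
        ultimately have "potential {q, ?q} ?M B ?S \<le> 2 * m"
          unfolding potential_def covered using q(1) by simp
        moreover obtain S' where S': "finite S'" "?S \<subseteq> S'" "edge_boundary S' \<inter> ?M = {}"
            "potential {q, ?q} ?M B S' \<le> potential {q, ?q} ?M B ?S"
          using closed_region_exists[OF pos' q(2), of ?S] S(1) by auto
        ultimately have pot: "potential {q, ?q} ?M B S' \<le> 2 * m" by linarith
        have r: "rank q S' < rank q S" using rank_less[of S S' x q] f S'(2) by blast
        have "rank ?q S' \<le> card (square ?q - {x})"
          unfolding rank_def using S'(2) by (intro card_mono) auto
        also have "\<dots> \<le> 3" using opp(1) by (simp add: card_square)
        finally have r': "rank ?q S' \<le> 3" .
        show ?thesis
        proof (rule two_square_reply[OF pos' S'(1) _ S'(3) q pot])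
          show "v0 \<in> S'" using S S' by blast
          show "wins m v0 N ?M B'" if "outside ?M S' = {}" "guarded v0 {q, ?q} ?M B' S'" for B'
            by (rule both_IH[OF q that(2,1)]) (use r r' N in linarith)
          show "wins m v0 N ?M B'" if "card (outside ?M S') = 1" "guarded v0 {p} ?M B' S'"
              "rank p S' = min (rank q S') (rank ?q S')" for B' p
            by (rule one_IH[OF that(2)]) (use that r N in linarith)+
        qed
      qed
    qed
    then show "wins m v0 (Suc N) M B" unfolding wins_Suc_iff by blast
  qed
qed

lemma wins_within_15:
  assumes "1 \<le> m"
  shows "wins m v0 15 {} {}"
proof -
  let ?q = "opposite v0 v0"
  have v0: "v0 \<in> square v0" by (cases v0) (simp add: square_def)
  note opp = opposite_square[OF v0]
  have bd: "edge_boundary {v0} \<subseteq> star v0" by (auto simp: edge_boundary_def star_def)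
  have gates: "card (gates {v0} {} q) \<le> 2" if "v0 \<in> square q" for q
  proof -
    have "gates {v0} {} q \<subseteq> star v0 \<inter> square_edges q" using bd by (auto simp: gates_def)
    then show ?thesis using card_mono[of "star v0 \<inter> square_edges q"] card_star_square[OF that] by auto
  qed
  have r: "rank q {v0} = 3" if "v0 \<in> square q" for q
    unfolding rank_def using that by (simp add: card_square)
  have "guarded v0 {v0, ?q} {} {} {v0}"
    using bd opp(4) gates[OF v0] gates[OF opp(1)] by (auto simp: guarded_def position_def)
  moreover have "disjoint_squares {v0, ?q}" "v0 \<noteq> ?q"
    using opp by (auto simp: disjoint_squares_def)
  moreover have "outside {} {v0} = {}" by (simp add: outside_def)
  moreover have "3 * min (rank v0 {v0}) (rank ?q {v0}) + rank v0 {v0} + rank ?q {v0} \<le> 15"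
    using r[OF v0] r[OF opp(1)] by simp
  ultimately show ?thesis
    using guarded_squares_win[OF assms, of v0 15, THEN conjunct1] by blast
qed

section \<open>Growing rectangles\<close>

definition rect :: "int \<Rightarrow> int \<Rightarrow> int \<Rightarrow> int \<Rightarrow> vertex set" where
  "rect x1 x2 y1 y2 = {x1..x2} \<times> {y1..y2}"

definition row_edges :: "int \<Rightarrow> int \<Rightarrow> int \<Rightarrow> edge set" where
  "row_edges x1 x2 y = (\<lambda>x. {(x, y), (x, y + 1)}) ` {x1..x2}"

definition col_edges :: "int \<Rightarrow> int \<Rightarrow> int \<Rightarrow> edge set" where
  "col_edges x y1 y2 = (\<lambda>y. {(x, y), (x + 1, y)}) ` {y1..y2}"

lemma finite_rect [simp]: "finite (rect x1 x2 y1 y2)"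
  by (simp add: rect_def)

lemma finite_row_edges [simp]: "finite (row_edges x1 x2 y)"
  by (simp add: row_edges_def)

lemma finite_col_edges [simp]: "finite (col_edges x y1 y2)"
  by (simp add: col_edges_def)

lemma card_row_edges: "card (row_edges x1 x2 y) \<le> nat (x2 - x1 + 1)"
  unfolding row_edges_def by (rule card_image_le[THEN le_trans]) auto

lemma card_col_edges: "card (col_edges x y1 y2) \<le> nat (y2 - y1 + 1)"
  unfolding col_edges_def by (rule card_image_le[THEN le_trans]) auto

lemma row_edges_split: "row_edges x1 x2 y \<subseteq> row_edges x1 (x - 1) y \<union> row_edges x x2 y"
  unfolding row_edges_def by (simp flip: image_Un) (rule image_mono, auto)

lemma col_edges_split: "col_edges x y1 y2 \<subseteq> col_edges x y1 (y - 1) \<union> col_edges x y y2"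
  unfolding col_edges_def by (simp flip: image_Un) (rule image_mono, auto)

text \<open>
  If all gates of \<open>U\<close> lead into a rectangle, then gluing the rectangle to \<open>U\<close> leaves only
  edges on the sides of the rectangle open, and none where the rectangle rests against \<open>U\<close>. Only the bottom
  and the left side are used to rest, hence the additional information in these two cases.
\<close>

lemma attached_rect_boundary:
  assumes absorbed: "\<forall>e \<in> edge_boundary U - B. e \<subseteq> U \<union> rect x1 x2 y1 y2"
    and e: "e \<in> edge_boundary (U \<union> rect x1 x2 y1 y2)" "e \<notin> B"
  obtains (top) x where "x1 \<le> x" "x \<le> x2" "e = {(x, y2), (x, y2 + 1)}"
  | (bottom) x where "x1 \<le> x" "x \<le> x2" "e = {(x, y1 - 1), (x, y1)}" "(x, y1 - 1) \<notin> U"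
  | (right) y where "y1 \<le> y" "y \<le> y2" "e = {(x2, y), (x2 + 1, y)}"
  | (left) y where "y1 \<le> y" "y \<le> y2" "e = {(x1 - 1, y), (x1, y)}" "(x1 - 1, y) \<notin> U"
proof -
  let ?P = "rect x1 x2 y1 y2"
  have eE: "e \<in> Z2_edges" using e edge_boundary_subset by blast
  obtain u where u: "u \<in> e" "u \<in> U \<union> ?P" using e by (auto simp: edge_boundary_def)
  obtain v where v: "e = {u, v}" "\<bar>fst u - fst v\<bar> + \<bar>snd u - snd v\<bar> = 1"
    using Z2_edgeE[OF eE u(1)] by blast
  have v_out: "v \<notin> U" "v \<notin> ?P" using e(1) u v by (auto simp: edge_boundary_def)
  have "u \<notin> U"
  proof
    assume "u \<in> U"
    then have "e \<in> edge_boundary U - B" using e eE v v_out by (auto simp: edge_boundary_def)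
    then show False using absorbed v v_out by blast
  qed
  then obtain x y where xy: "u = (x, y)" "x1 \<le> x" "x \<le> x2" "y1 \<le> y" "y \<le> y2"
    using u by (auto simp: rect_def)
  consider "v = (x + 1, y)" | "v = (x - 1, y)" | "v = (x, y + 1)" | "v = (x, y - 1)"
    using neighbour_cases[OF v(2)] xy(1) by auto
  then show thesis
  proof cases
    case 1
    moreover from this have "x = x2" using v_out xy by (auto simp: rect_def)
    ultimately show thesis using right[of y] v(1) xy by simp
  next
    case 2
    moreover from this have "x = x1" using v_out xy by (auto simp: rect_def)
    ultimately show thesis using left[of y] v(1) v_out xy by (simp add: insert_commute)
  next
    case 3
    moreover from this have "y = y2" using v_out xy by (auto simp: rect_def)
    ultimately show thesis using top[of x] v(1) xy by simp
  next
    case 4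
    moreover from this have "y = y1" using v_out xy by (auto simp: rect_def)
    ultimately show thesis using bottom[of x] v(1) v_out xy by (simp add: insert_commute)
  qed
qed

lemma rect_boundary:
  "edge_boundary (rect x1 x2 y1 y2) \<subseteq> row_edges x1 x2 y2 \<union> row_edges x1 x2 (y1 - 1) \<union>
     col_edges x2 y1 y2 \<union> col_edges (x1 - 1) y1 y2"
proof
  fix e assume "e \<in> edge_boundary (rect x1 x2 y1 y2)"
  then have "e \<in> edge_boundary ({} \<union> rect x1 x2 y1 y2)" "e \<notin> {}" by simp_all
  then show "e \<in> row_edges x1 x2 y2 \<union> row_edges x1 x2 (y1 - 1) \<union>
     col_edges x2 y1 y2 \<union> col_edges (x1 - 1) y1 y2"
    by (rule attached_rect_boundary[rotated]) (auto simp: edge_boundary_def row_edges_def col_edges_def)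
qed

text \<open>
  Moving the side that a Maker edge crosses out by one takes this edge inside.
\<close>

lemma closed_rect_exists:
  assumes "finite M" "M \<subseteq> Z2_edges" "x1 \<le> x2" "y1 \<le> y2"
  shows "\<exists>x1' x2' y1' y2'. rect x1 x2 y1 y2 \<subseteq> rect x1' x2' y1' y2' \<and>
    edge_boundary (rect x1' x2' y1' y2') \<inter> M = {} \<and> x1' \<le> x2' \<and> y1' \<le> y2' \<and>
    (x2' - x1') + (y2' - y1') + int (card (outside M (rect x1' x2' y1' y2'))) \<le>
    (x2 - x1) + (y2 - y1) + int (card (outside M (rect x1 x2 y1 y2)))"
  using assms(3,4)
proof (induction "card (outside M (rect x1 x2 y1 y2))" arbitrary: x1 x2 y1 y2 rule: less_induct)
  case less
  let ?R = "rect x1 x2 y1 y2"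
  show ?case
  proof (cases "edge_boundary ?R \<inter> M = {}")
    case True
    then show ?thesis using less.prems by blast
  next
    case False
    then obtain e where e: "e \<in> M" "e \<in> edge_boundary ({} \<union> ?R)" by auto
    have grow: ?thesis if "rect x1 x2 y1 y2 \<subseteq> rect a b c d" "e \<subseteq> rect a b c d" "a \<le> b" "c \<le> d"
      "(b - a) + (d - c) = (x2 - x1) + (y2 - y1) + 1" for a b c d
    proof -
      have out: "card (outside M (rect a b c d)) + 1 \<le> card (outside M ?R)"
        by (rule card_outside_less[OF assms(1) e(1) that(2) _ that(1)])
          (use e(2) in \<open>auto simp: edge_boundary_def\<close>)
      then show ?thesis
        using less.hyps[of a b c d] that by (smt (verit, best) order_trans of_nat_mono of_nat_add of_nat_1
          Suc_eq_plus1 Suc_le_eq)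
    qed
    show ?thesis
    proof (rule attached_rect_boundary[of "{}" "{}", OF _ e(2)])
      show "\<forall>e\<in>edge_boundary {} - {}. e \<subseteq> {} \<union> ?R" by (simp add: edge_boundary_def)
      show "e \<notin> {}" by simp
      show ?thesis if "x1 \<le> x" "x \<le> x2" "e = {(x, y2), (x, y2 + 1)}" for x
        by (rule grow[of x1 x2 y1 "y2 + 1"]) (use that less.prems in \<open>auto simp: rect_def\<close>)
      show ?thesis if "x1 \<le> x" "x \<le> x2" "e = {(x, y1 - 1), (x, y1)}" for x
        by (rule grow[of x1 x2 "y1 - 1" y2]) (use that less.prems in \<open>auto simp: rect_def\<close>)
      show ?thesis if "y1 \<le> y" "y \<le> y2" "e = {(x2, y), (x2 + 1, y)}" for y
        by (rule grow[of x1 "x2 + 1" y1 y2]) (use that less.prems in \<open>auto simp: rect_def\<close>)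
      show ?thesis if "y1 \<le> y" "y \<le> y2" "e = {(x1 - 1, y), (x1, y)}" for y
        by (rule grow[of "x1 - 1" x2 y1 y2]) (use that less.prems in \<open>auto simp: rect_def\<close>)
    qed
  qed
qed

section \<open>A pocket closes\<close>

text \<open>
  The vertex \<open>(a, c)\<close> is the corner of a quadrant with a floor below and a wall on the left, and the gates are
  the lowest \<open>g\<close> edges of the wall. A rectangle in the corner, with \<open>1 + i\<close> columns and \<open>g + j\<close> rows, is open
  only above and on the right. Once Maker has used a gate, the potential of the rectangle with \<open>i = j = 0\<close> is
  at most \<open>1 + g + 2 * (m + e - 1) \<le> 2 * m + 3\<close>, and each enlargement adds one open edge while
  it takes a Maker edge inside. After three enlargements the potential is at most
  \<open>2 * m\<close>. Up to then the rectangle has at most 4 columns and 7 rows, which is how far floor and wall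
  must reach.
\<close>

lemma pocket_reply:
  assumes m: "4 \<le> m" and pos: "position M B" and U: "finite U" "v0 \<in> U"
    and floor: "\<And>x. a \<le> x \<Longrightarrow> x \<le> a + 3 \<Longrightarrow> (x, c - 1) \<in> U"
    and wall: "\<And>y. c \<le> y \<Longrightarrow> y \<le> c + 6 \<Longrightarrow> (a - 1, y) \<in> U"
    and gates: "edge_boundary U - B \<subseteq> col_edges (a - 1) c (c + int g - 1)"
    and out: "card (outside M U) \<le> m + e" "g + 2 * e \<le> 4" "1 \<le> g"
  shows "can_reply m v0 n M B"
proof (cases "edge_boundary U \<inter> M = {}")
  case True
  have "card (edge_boundary U - B) \<le> card (col_edges (a - 1) c (c + int g - 1))"
    by (rule card_mono) (use gates in auto)
  then have "card (edge_boundary U - B) \<le> 2 * m"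
    using card_col_edges[of "a - 1" c "c + int g - 1"] out m by linarith
  then show ?thesis using can_reply_sealing U True by blast
next
  case False
  define P where "P i j = rect a (a + int i) c (c + int g - 1 + int j)" for i j :: nat
  have absorbed: "\<forall>e \<in> edge_boundary U - B. e \<subseteq> U \<union> P i j" for i j
  proof
    fix e assume "e \<in> edge_boundary U - B"
    then have "e \<in> col_edges (a - 1) c (c + int g - 1)" using gates by blast
    then obtain y where "c \<le> y" "y \<le> c + int g - 1" "e = {(a - 1, y), (a, y)}"
      unfolding col_edges_def by auto
    moreover from this have "(a - 1, y) \<in> U" using wall[of y] out by auto
    ultimately show "e \<subseteq> U \<union> P i j" by (auto simp: P_def rect_def)
  qed
  have pos': "finite M" "M \<inter> B = {}" using pos by (auto simp: position_def)
  have grow: "can_reply m v0 n M B"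
    if "i + j \<le> 3" "i + j + card (outside M (U \<union> P i j)) + 1 \<le> m + e" for i j
    using that
  proof (induction "3 - (i + j)" arbitrary: i j rule: less_induct)
    case less
    let ?S = "U \<union> P i j"
    have S: "finite ?S" "v0 \<in> ?S" using U by (auto simp: P_def)
    have boundary: thesis
      if "f \<in> edge_boundary ?S" "f \<notin> B"
        and top: "\<And>x. a \<le> x \<Longrightarrow> x \<le> a + int i \<Longrightarrow>
          f = {(x, c + int g - 1 + int j), (x, c + int g - 1 + int j + 1)} \<Longrightarrow> thesis"
        and right: "\<And>y. c \<le> y \<Longrightarrow> y \<le> c + int g - 1 + int j \<Longrightarrow>
          f = {(a + int i, y), (a + int i + 1, y)} \<Longrightarrow> thesis" for f thesis
      by (rule attached_rect_boundary[OF absorbed[unfolded P_def] that(1)[unfolded P_def] that(2)])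
        (use top right floor wall less.prems(1) out in auto)
    have "edge_boundary ?S - B \<subseteq> row_edges a (a + int i) (c + int g - 1 + int j) \<union>
        col_edges (a + int i) c (c + int g - 1 + int j) \<union> {}"
    proof
      fix f assume "f \<in> edge_boundary ?S - B"
      then have f: "f \<in> edge_boundary ?S" "f \<notin> B" by auto
      show "f \<in> row_edges a (a + int i) (c + int g - 1 + int j) \<union>
        col_edges (a + int i) c (c + int g - 1 + int j) \<union> {}"
        by (rule boundary[OF f]) (auto simp: row_edges_def col_edges_def)
    qed
    from card_le_union3[OF this] have cost: "card (edge_boundary ?S - B) \<le> (i + 1) + (g + j)"
      using card_row_edges[of a "a + int i" "c + int g - 1 + int j"]
        card_col_edges[of "a + int i" c "c + int g - 1 + int j"] by simp
    show ?case
    proof (cases "edge_boundary ?S \<inter> M = {}")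
      case True
      show ?thesis
        by (rule can_reply_sealing[OF S True]) (use cost less.prems(1) out m in linarith)
    next
      case False
      show ?thesis
      proof (cases "i + j = 3")
        case True
        have "potential {} M B ?S \<le> 2 * m"
          unfolding potential_empty using cost less.prems(2) out True by linarith
        then show ?thesis using can_reply_if_potential_small[OF pos S] by blast
      next
        case ij: False
        obtain f where f: "f \<in> edge_boundary ?S" "f \<in> M" using False by blast
        then have fB: "f \<notin> B" using pos' by blast
        have step: ?thesis if "i' + j' = i + j + 1" "f \<subseteq> U \<union> P i' j'" "P i j \<subseteq> P i' j'" for i' j'
        proof (rule less.hyps)
          have "card (outside M (U \<union> P i' j')) + 1 \<le> card (outside M ?S)"
            by (rule card_outside_less[OF pos'(1) f(2) that(2)])
              (use f that(3) in \<open>auto simp: edge_boundary_def\<close>)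
          then show "i' + j' + card (outside M (U \<union> P i' j')) + 1 \<le> m + e"
            using less.prems(2) that(1) by linarith
        qed (use that(1) less.prems(1) ij in auto)
        show ?thesis
        proof (rule boundary[OF f(1) fB])
          show ?thesis if "a \<le> x" "x \<le> a + int i"
            "f = {(x, c + int g - 1 + int j), (x, c + int g - 1 + int j + 1)}" for x
            by (rule step[of i "j + 1"]) (use that out in \<open>auto simp: P_def rect_def\<close>)
          show ?thesis if "c \<le> y" "y \<le> c + int g - 1 + int j"
            "f = {(a + int i, y), (a + int i + 1, y)}" for y
            by (rule step[of "i + 1" j]) (use that out in \<open>auto simp: P_def rect_def\<close>)
        qed
      qed
    qed
  qed
  obtain f where f: "f \<in> edge_boundary U" "f \<in> M" using False by blast
  have "card (outside M (U \<union> P 0 0)) + 1 \<le> card (outside M U)"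
    by (rule card_outside_less[OF pos'(1) f(2)])
      (use f pos' absorbed[of 0 0] in \<open>auto simp: edge_boundary_def\<close>)
  then show ?thesis using grow[of 0 0] out by simp
qed

section \<open>A tower on a long floor\<close>

text \<open>
  The gates are \<open>g\<close> consecutive edges of a floor. Once Maker has used one of them, a tower of width
  \<open>g + i + j\<close> and height \<open>h + 1\<close> stands on the floor, grown from a row over the gates whose
  potential is at most \<open>g + 2 + 2 * (m + e - 1) \<le> 2 * m + 4\<close>. Raising the tower
  costs two open edges and widening it only one, against two for the Maker edge taken inside, so four widenings
  win. If Maker's edges are enclosed after at most three widenings and Breaker cannot seal the tower, it has at
  least \<open>2 * m + 1\<close> open edges but width at most 7, so its right wall is high enough for a pocket. The floor
  reaches 4 to the left of the gates for the widenings, and to the right far enough for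
  four gates, three widenings and the four columns of the pocket.
\<close>

lemma tower_reply:
  assumes m: "10 \<le> m" and pos: "position M B" and U: "finite U" "v0 \<in> U"
    and floor: "\<And>x. p - 4 \<le> x \<Longrightarrow> x \<le> p + 10 \<Longrightarrow> (x, c - 1) \<in> U"
    and gates: "edge_boundary U - B \<subseteq> row_edges p (p + int g - 1) (c - 1)"
    and out: "card (outside M U) \<le> m + e" "g + 2 * e \<le> 4" "1 \<le> g"
  shows "can_reply m v0 1 M B"
proof (cases "edge_boundary U \<inter> M = {}")
  case True
  have "card (edge_boundary U - B) \<le> card (row_edges p (p + int g - 1) (c - 1))"
    by (rule card_mono) (use gates in auto)
  then have "card (edge_boundary U - B) \<le> 2 * m"
    using card_row_edges[of p "p + int g - 1" "c - 1"] out m by linarith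
  then show ?thesis using can_reply_sealing U True by blast
next
  case False
  define T where "T i j h = rect (p - int i) (p + int g - 1 + int j) c (c + int h)" for i j h :: nat
  have absorbed: "\<forall>e \<in> edge_boundary U - B. e \<subseteq> U \<union> T i j h" for i j h
  proof
    fix e assume "e \<in> edge_boundary U - B"
    then have "e \<in> row_edges p (p + int g - 1) (c - 1)" using gates by blast
    then obtain x where "p \<le> x" "x \<le> p + int g - 1" "e = {(x, c - 1), (x, c)}"
      unfolding row_edges_def by auto
    moreover from this have "(x, c - 1) \<in> U" using floor[of x] out by auto
    ultimately show "e \<subseteq> U \<union> T i j h" by (auto simp: T_def rect_def)
  qed
  have pos': "finite M" "M \<inter> B = {}" using pos by (auto simp: position_def)
  have grow: "can_reply m v0 1 M B"
    if "i + j \<le> 4" "i + j + (h + 1) + card (outside M (U \<union> T i j h)) \<le> m + e" for i j h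
    using that
  proof (induction "card (outside M (U \<union> T i j h))" arbitrary: i j h rule: less_induct)
    case less
    let ?S = "U \<union> T i j h" and ?xl = "p - int i" and ?xr = "p + int g - 1 + int j"
      and ?out = "card (outside M (U \<union> T i j h))"
    have S: "finite ?S" "v0 \<in> ?S" using U by (auto simp: T_def)
    have boundary: thesis
      if "f \<in> edge_boundary ?S" "f \<notin> B"
        and top: "\<And>x. ?xl \<le> x \<Longrightarrow> x \<le> ?xr \<Longrightarrow> f = {(x, c + int h), (x, c + int h + 1)} \<Longrightarrow> thesis"
        and right: "\<And>y. c \<le> y \<Longrightarrow> y \<le> c + int h \<Longrightarrow> f = {(?xr, y), (?xr + 1, y)} \<Longrightarrow> thesis"
        and left: "\<And>y. c \<le> y \<Longrightarrow> y \<le> c + int h \<Longrightarrow> f = {(?xl - 1, y), (?xl, y)} \<Longrightarrow> thesis"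
      for f thesis
      by (rule attached_rect_boundary[OF absorbed[unfolded T_def] that(1)[unfolded T_def] that(2)])
        (use top right left floor less.prems(1) out in auto)
    have sub: "edge_boundary ?S - B \<subseteq> row_edges ?xl ?xr (c + int h) \<union>
        col_edges ?xr c (c + int h) \<union> col_edges (?xl - 1) c (c + int h)"
    proof
      fix f assume "f \<in> edge_boundary ?S - B"
      then have f: "f \<in> edge_boundary ?S" "f \<notin> B" by auto
      show "f \<in> row_edges ?xl ?xr (c + int h) \<union>
        col_edges ?xr c (c + int h) \<union> col_edges (?xl - 1) c (c + int h)"
        by (rule boundary[OF f]) (auto simp: row_edges_def col_edges_def)
    qed
    have sides: "card (row_edges ?xl ?xr (c + int h)) \<le> g + i + j"
      "card (col_edges ?xr c (c + int h)) \<le> h + 1"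
      "card (col_edges (?xl - 1) c (c + int h)) \<le> h + 1"
      using card_row_edges[of ?xl ?xr "c + int h"] card_col_edges[of ?xr c "c + int h"]
        card_col_edges[of "?xl - 1" c "c + int h"] out by linarith+
    have cost: "card (edge_boundary ?S - B) \<le> g + i + j + 2 * h + 2"
      using card_le_union3[OF sub] sides by simp
    show ?case
    proof (cases "i + j = 4")
      case True
      have "potential {} M B ?S \<le> 2 * m"
      proof -
        have "card (edge_boundary ?S - B) \<le> g + 6 + 2 * h" using cost True by simp
        moreover have "4 + (h + 1) + ?out \<le> m + e" using less.prems(2) True by simp
        ultimately show ?thesis unfolding potential_empty using out(2) by arith
      qed
      then show ?thesis using can_reply_if_potential_small[OF pos S] by blast
    next
      case ij: False
      show ?thesis
      proof (cases "edge_boundary ?S \<inter> M = {}")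
        case False
        obtain f where f: "f \<in> edge_boundary ?S" "f \<in> M" using False by blast
        then have fB: "f \<notin> B" using pos' by blast
        have step: ?thesis if "i' + j' + h' = i + j + h + 1" "i' + j' \<le> 4"
          "f \<subseteq> U \<union> T i' j' h'" "T i j h \<subseteq> T i' j' h'" for i' j' h'
        proof -
          have less_out: "card (outside M (U \<union> T i' j' h')) + 1 \<le> ?out"
            by (rule card_outside_less[OF pos'(1) f(2) that(3)])
              (use f that(4) in \<open>auto simp: edge_boundary_def\<close>)
          show ?thesis
            by (rule less.hyps[of i' j' h']) (use less_out less.prems(2) that(1,2) in linarith)+
        qed
        show ?thesis
        proof (rule boundary[OF f(1) fB])
          show ?thesis if "?xl \<le> x" "x \<le> ?xr" "f = {(x, c + int h), (x, c + int h + 1)}" for x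
            by (rule step[of i j "h + 1"]) (use that out less.prems(1) in \<open>auto simp: T_def rect_def\<close>)
          show ?thesis if "c \<le> y" "y \<le> c + int h" "f = {(?xr, y), (?xr + 1, y)}" for y
            by (rule step[of i "j + 1" h]) (use that out less.prems(1) ij in \<open>auto simp: T_def rect_def\<close>)
          show ?thesis if "c \<le> y" "y \<le> c + int h" "f = {(?xl - 1, y), (?xl, y)}" for y
            by (rule step[of "i + 1" j h]) (use that out less.prems(1) ij in \<open>auto simp: T_def rect_def\<close>)
        qed
      next
        case closed: True
        show ?thesis
        proof (cases "g + i + j + 2 * h + 2 \<le> 2 * m")
          case True
          show ?thesis
            by (rule can_reply_sealing[OF S closed]) (use True cost in linarith)
        next
          case False
          moreover have "i + j \<le> 3" "g \<le> 4" using less.prems(1) ij out(2) by linarith+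
          ultimately have high: "6 \<le> h" using m by linarith
          have "2 * i + 2 * j + 2 * h + 2 + 2 * ?out \<le> 2 * m + 2 * e" using less.prems(2) by simp
          then have few: "?out \<le> 1" using False out(2) by linarith
          \<comment> \<open>Breaker leaves open the lowest \<open>g'\<close> edges of the right wall.\<close>
          define g' where "g' = 4 - 2 * ?out"
          have g': "g' + 2 * ?out = 4" using few by (simp add: g'_def)
          let ?K = "col_edges ?xr c (c + int g' - 1)"
          let ?B = "B \<union> (edge_boundary ?S - ?K)"
          have "edge_boundary ?S - B - ?K \<subseteq> row_edges ?xl ?xr (c + int h) \<union>
              col_edges ?xr (c + int g') (c + int h) \<union> col_edges (?xl - 1) c (c + int h)"
            using sub col_edges_split[of ?xr c "c + int h" "c + int g'"] by blast
          from card_le_union3[OF this] have "card (edge_boundary ?S - B - ?K) \<le>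
              (g + i + j) + card (col_edges ?xr (c + int g') (c + int h)) + (h + 1)"
            using sides by simp
          moreover have "card (col_edges ?xr (c + int g') (c + int h)) + g' \<le> h + 1"
            using card_col_edges[of ?xr "c + int g'" "c + int h"] high g' by linarith
          ultimately have few_claims: "card (edge_boundary ?S - B - ?K) \<le> 2 * m"
            using less.prems(2) out g' by arith
          have "can_reply m v0 0 (M \<union> X) ?B"
            if X: "X \<subseteq> Z2_edges - (M \<union> ?B)" "finite X" "card X = m" for X
          proof (rule pocket_reply[where a = "?xr + 1" and c = c and g = g' and e = ?out])
            have "position M ?B" using pos closed by (auto simp: position_def)
            then show "position (M \<union> X) ?B" using position_add X by blast
            show "card (outside (M \<union> X) ?S) \<le> m + ?out"
              using card_outside_Un[OF pos'(1) X(2), of ?S] X(3) by simp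
            show "edge_boundary ?S - ?B \<subseteq> col_edges (?xr + 1 - 1) c (c + int g' - 1)"
              unfolding add_diff_cancel_right' by blast
            show "(x, c - 1) \<in> ?S" if "?xr + 1 \<le> x" "x \<le> ?xr + 1 + 3" for x
              using floor[of x] that less.prems(1) ij out by auto
            show "(?xr + 1 - 1, y) \<in> ?S" if "c \<le> y" "y \<le> c + 6" for y
              using that high out by (auto simp: T_def rect_def)
          qed (use S m few g' in auto)
          then have "wins m v0 1 M ?B" unfolding One_nat_def wins_Suc_iff by blast
          then show ?thesis using can_reply_keeping[OF S(1) closed few_claims] by blast
        qed
      qed
    qed
  qed
  obtain f where f: "f \<in> edge_boundary U" "f \<in> M" using False by blast
  have "card (outside M (U \<union> T 0 0 0)) + 1 \<le> card (outside M U)"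
    by (rule card_outside_less[OF pos'(1) f(2)])
      (use f pos' absorbed[of 0 0 0] in \<open>auto simp: edge_boundary_def\<close>)
  then show ?thesis using grow[of 0 0 0] out by simp
qed

section \<open>Three rounds\<close>

text \<open>
  The perimeter of the rectangle is at most \<open>2 * m + 4 - 2 * k\<close>, where \<open>k\<close> Maker edges are outside. So Breaker
  seals it if \<open>k \<ge> 2\<close>, and otherwise leaves \<open>4 - 2 * k\<close> gates on the long side. They start 4 to
  the right of the left end of the upper side, which makes this side a floor as \<open>tower_reply\<close> demands.
\<close>

lemma long_rect_reply:
  assumes m: "10 \<le> m" and pos: "position M {}"
    and R: "v0 \<in> rect x1 x2 y1 y2" "edge_boundary (rect x1 x2 y1 y2) \<inter> M = {}"
      "x1 + 14 \<le> x2" "y1 \<le> y2"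
    and size: "(x2 - x1) + (y2 - y1) + int (card (outside M (rect x1 x2 y1 y2))) \<le> int m"
  shows "can_reply m v0 2 M {}"
proof -
  let ?R = "rect x1 x2 y1 y2" and ?out = "card (outside M (rect x1 x2 y1 y2))"
  have fin: "finite ?R" "finite M" using pos by (simp_all add: position_def)
  define g where "g = 4 - 2 * ?out"
  define p where "p = x1 + 4"
  let ?K = "if 2 \<le> ?out then {} else row_edges p (p + int g - 1) y2"
  have bound: "card (edge_boundary ?R - {} - ?K) \<le> 2 * m"
  proof -
    let ?w = "nat (x2 - x1 + 1)" and ?h = "nat (y2 - y1 + 1)"
    have sides: "card (row_edges x1 x2 (y1 - 1)) \<le> ?w" "card (row_edges x1 x2 y2) \<le> ?w"
      "card (col_edges x2 y1 y2) \<le> ?h" "card (col_edges (x1 - 1) y1 y2) \<le> ?h"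
      by (rule card_row_edges card_col_edges)+
    have "edge_boundary ?R - {} - ?K \<subseteq>
        (row_edges x1 x2 y2 - ?K \<union> row_edges x1 x2 (y1 - 1)) \<union> col_edges x2 y1 y2 \<union> col_edges (x1 - 1) y1 y2"
      using rect_boundary[of x1 x2 y1 y2] by blast
    from card_le_union3[OF this] have "card (edge_boundary ?R - {} - ?K) \<le>
        card (row_edges x1 x2 y2 - ?K \<union> row_edges x1 x2 (y1 - 1)) + 2 * ?h"
      using sides by simp
    also have "card (row_edges x1 x2 y2 - ?K \<union> row_edges x1 x2 (y1 - 1)) \<le>
        card (row_edges x1 x2 y2 - ?K) + ?w"
      using card_Un_le[of "row_edges x1 x2 y2 - ?K" "row_edges x1 x2 (y1 - 1)"] sides by linarith
    finally have all: "card (edge_boundary ?R - {} - ?K) \<le> card (row_edges x1 x2 y2 - ?K) + ?w + 2 * ?h"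
      by simp
    show ?thesis
    proof (cases "2 \<le> ?out")
      case True
      then have "card (row_edges x1 x2 y2 - ?K) \<le> ?w" using sides by simp
      then show ?thesis using all size R(3,4) True by linarith
    next
      case False
      then have g: "g + 2 * ?out = 4" by (simp add: g_def)
      have "row_edges x1 x2 y2 - ?K \<subseteq> row_edges x1 (p - 1) y2 \<union> row_edges (p + int g) x2 y2 \<union> {}"
        using False row_edges_split[of x1 x2 y2 p] row_edges_split[of p x2 y2 "p + int g"] by auto
      from card_le_union3[OF this] have "card (row_edges x1 x2 y2 - ?K) \<le>
          nat (p - x1) + nat (x2 - (p + int g) + 1)"
        using card_row_edges[of x1 "p - 1" y2] card_row_edges[of "p + int g" x2 y2] by simp
      moreover have "nat (p - x1) + nat (x2 - (p + int g) + 1) + g = ?w"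
        using R(3) g by (simp add: p_def)
      ultimately show ?thesis using all size R(3,4) g by linarith
    qed
  qed
  show ?thesis
  proof (cases "2 \<le> ?out")
    case True
    then show ?thesis using can_reply_sealing[OF fin(1) R(1,2)] bound by simp
  next
    case False
    then have g: "g + 2 * ?out = 4" and K: "?K = row_edges p (p + int g - 1) y2"
      by (simp_all add: g_def)
    let ?B = "{} \<union> (edge_boundary ?R - ?K)"
    have "can_reply m v0 1 (M \<union> X) ?B"
      if X: "X \<subseteq> Z2_edges - (M \<union> ?B)" "finite X" "card X = m" for X
    proof (rule tower_reply[where U = ?R and p = p and c = "y2 + 1" and g = g and e = ?out])
      have "position M ?B" using pos R(2) by (auto simp: position_def)
      then show "position (M \<union> X) ?B" using position_add X by blast
      show "card (outside (M \<union> X) ?R) \<le> m + ?out"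
        using card_outside_Un[OF fin(2) X(2), of ?R] X(3) by simp
      show "edge_boundary ?R - ?B \<subseteq> row_edges p (p + int g - 1) (y2 + 1 - 1)"
        unfolding K add_diff_cancel_right' by blast
      show "(x, y2 + 1 - 1) \<in> ?R" if "p - 4 \<le> x" "x \<le> p + 10" for x
        using that R(3,4) by (simp add: rect_def p_def)
    qed (use fin R(1) m False g in auto)
    then have "wins m v0 2 M ?B" unfolding numeral_2_eq_2 wins_Suc_iff One_nat_def by blast
    then show ?thesis using can_reply_keeping[OF fin(1) R(2) bound] by blast
  qed
qed

text \<open>
  Reflection in the diagonal carries rectangles that are high over to rectangles that are wide.
\<close>

definition mirror :: "edge set \<Rightarrow> edge set" where
  "mirror M = (`) prod.swap ` M"

lemma swap_image_swap: "prod.swap ` prod.swap ` S = S"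
  by (simp add: image_image)

lemma swap_image_subset: "prod.swap ` e \<subseteq> S \<longleftrightarrow> e \<subseteq> prod.swap ` S"
  by (metis image_mono swap_image_swap)

lemma mem_mirror_iff: "e \<in> mirror M \<longleftrightarrow> prod.swap ` e \<in> M"
  unfolding mirror_def using swap_image_swap by (metis (no_types, lifting) imageE image_eqI)

lemma swap_mem_Z2_edges:
  assumes "e \<in> Z2_edges"
  shows "prod.swap ` e \<in> Z2_edges"
proof -
  obtain u v where "e = {u, v}" using assms unfolding Z2_edges_def by blast
  then show ?thesis using assms by (simp add: Z2_edge_iff add.commute)
qed

lemma mirror_Z2_edges: "mirror Z2_edges = Z2_edges"
proof (rule set_eqI)
  fix e
  show "e \<in> mirror Z2_edges \<longleftrightarrow> e \<in> Z2_edges"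
    using swap_mem_Z2_edges[of e] swap_mem_Z2_edges[of "prod.swap ` e"]
    unfolding mem_mirror_iff swap_image_swap by blast
qed

lemma mirror_simps:
  "mirror (mirror M) = M" "mirror (M \<union> N) = mirror M \<union> mirror N" "mirror (M - N) = mirror M - mirror N"
  "mirror {} = {}"
  by (auto simp: mem_mirror_iff swap_image_swap)

lemma mirror_mono: "M \<subseteq> N \<Longrightarrow> mirror M \<subseteq> mirror N"
  by (auto simp: mirror_def)

lemma card_mirror: "card (mirror M) = card M"
  unfolding mirror_def by (rule card_image) (metis inj_on_def swap_image_swap)

lemma finite_mirror: "finite M \<Longrightarrow> finite (mirror M)"
  by (simp add: mirror_def)

lemma edge_boundary_swap: "edge_boundary (prod.swap ` S) = mirror (edge_boundary S)"
proof -
  have "prod.swap ` e \<inter> S = prod.swap ` (e \<inter> prod.swap ` S)" for e :: edge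
    by (simp add: image_Int swap_image_swap)
  then have "prod.swap ` e \<inter> S = {} \<longleftrightarrow> e \<inter> prod.swap ` S = {}" for e :: edge
    by simp
  moreover have "prod.swap ` e \<in> Z2_edges \<longleftrightarrow> e \<in> Z2_edges" for e
    using mirror_Z2_edges mem_mirror_iff[of e Z2_edges] by simp
  ultimately show ?thesis
    by (intro set_eqI) (simp only: mem_mirror_iff edge_boundary_def mem_Collect_eq swap_image_subset)
qed

lemma legal_mirror: "X \<subseteq> Z2_edges - (M \<union> B) \<Longrightarrow> mirror X \<subseteq> Z2_edges - (mirror M \<union> mirror B)"
  using mirror_mono[of X "Z2_edges - (M \<union> B)"] by (simp add: mirror_simps mirror_Z2_edges)

lemma sealed_mirror: "sealed v0 B \<Longrightarrow> sealed (prod.swap v0) (mirror B)"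
  unfolding sealed_def using mirror_mono edge_boundary_swap by (metis finite_imageI imageI)

lemma wins_mirror: "wins m v0 n M B \<Longrightarrow> wins m (prod.swap v0) n (mirror M) (mirror B)"
proof (induction n arbitrary: M B)
  case 0
  then show ?case by (simp add: sealed_mirror)
next
  case (Suc n)
  show ?case
  proof (cases "sealed v0 B")
    case True
    then show ?thesis using sealed_mirror sealed_imp_wins by blast
  next
    case False
    have "can_reply m (prod.swap v0) n (mirror M \<union> X) (mirror B)"
      if X: "X \<subseteq> Z2_edges - (mirror M \<union> mirror B)" "finite X" "card X = m" for X
    proof -
      have "mirror X \<subseteq> Z2_edges - (M \<union> B)"
        using legal_mirror[OF X(1)] by (simp add: mirror_simps)
      then have "can_reply m v0 n (M \<union> mirror X) B"
        using Suc.prems False X finite_mirror card_mirror unfolding wins_Suc_iff by metis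
      then obtain Y where Y: "Y \<subseteq> Z2_edges - (M \<union> mirror X \<union> B)" "finite Y" "card Y \<le> 2 * m"
          "wins m v0 n (M \<union> mirror X) (B \<union> Y)"
        unfolding can_reply_def by blast
      have "mirror Y \<subseteq> Z2_edges - (mirror M \<union> X \<union> mirror B)"
        using legal_mirror[OF Y(1)] by (simp add: mirror_simps)
      moreover have "wins m (prod.swap v0) n (mirror M \<union> X) (mirror B \<union> mirror Y)"
        using Suc.IH[OF Y(4)] by (simp add: mirror_simps)
      ultimately show ?thesis
        unfolding can_reply_def using Y(2,3) finite_mirror card_mirror by metis
    qed
    then show ?thesis unfolding wins_Suc_iff by blast
  qed
qed

lemma can_reply_mirror:
  assumes "can_reply m v0 n M B"
  shows "can_reply m (prod.swap v0) n (mirror M) (mirror B)"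
proof -
  obtain Y where Y: "Y \<subseteq> Z2_edges - (M \<union> B)" "finite Y" "card Y \<le> 2 * m" "wins m v0 n M (B \<union> Y)"
    using assms unfolding can_reply_def by blast
  have "wins m (prod.swap v0) n (mirror M) (mirror B \<union> mirror Y)"
    using wins_mirror[OF Y(4)] by (simp add: mirror_simps)
  then show ?thesis
    unfolding can_reply_def using legal_mirror[OF Y(1)] Y(2,3) finite_mirror card_mirror by metis
qed

lemma swap_rect: "prod.swap ` rect x1 x2 y1 y2 = rect y1 y2 x1 x2"
  by (auto simp: rect_def)

lemma outside_mirror: "outside (mirror M) (prod.swap ` S) = mirror (outside M S)"
  by (rule set_eqI) (simp only: mem_mirror_iff outside_def mem_Collect_eq swap_image_subset)

text \<open>
  The bounding rectangle of \<open>v0\<close> and the Maker edges that connect to it has \<open>(x2 - x1) + (y2 - y1) \<le> m\<close>. If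
  neither side has 15 vertices, its perimeter is at most 56, and Breaker seals it with his first move.
\<close>

lemma wins_within_3:
  assumes m: "29 \<le> m"
  shows "wins m v0 3 {} {}"
proof -
  have "can_reply m v0 2 ({} \<union> X) {}" if X: "X \<subseteq> Z2_edges - ({} \<union> {})" "finite X" "card X = m" for X
  proof -
    have pos: "position X {}" using X by (auto simp: position_def)
    have "rect (fst v0) (fst v0) (snd v0) (snd v0) = {v0}" by (cases v0) (auto simp: rect_def)
    moreover have "card (outside X {v0}) \<le> m"
      using X card_mono[of X "outside X {v0}"] by (auto simp: outside_def)
    ultimately obtain x1 x2 y1 y2 where R: "v0 \<in> rect x1 x2 y1 y2"
        "edge_boundary (rect x1 x2 y1 y2) \<inter> X = {}" "x1 \<le> x2" "y1 \<le> y2"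
        and size: "(x2 - x1) + (y2 - y1) + int (card (outside X (rect x1 x2 y1 y2))) \<le> int m"
      using closed_rect_exists[of X "fst v0" "fst v0" "snd v0" "snd v0"] X by fastforce
    consider "x1 + 14 \<le> x2" | "y1 + 14 \<le> y2" | "x2 < x1 + 14" "y2 < y1 + 14" by linarith
    then have "can_reply m v0 2 X {}"
    proof cases
      case 1
      show ?thesis by (rule long_rect_reply[OF _ pos R(1,2) 1 R(4) size]) (use m in simp)
    next
      case 2
      have "can_reply m (prod.swap v0) 2 (mirror X) {}"
      proof (rule long_rect_reply[OF _ _ _ _ 2 R(3)])
        show "position (mirror X) {}"
          using pos mirror_mono[of X Z2_edges] finite_mirror mirror_Z2_edges by (auto simp: position_def)
        show "prod.swap v0 \<in> rect y1 y2 x1 x2" using R(1) swap_rect by blast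
        have "edge_boundary (rect y1 y2 x1 x2) = mirror (edge_boundary (rect x1 x2 y1 y2))"
          unfolding swap_rect[symmetric, of y1 y2 x1 x2] using edge_boundary_swap by blast
        then show "edge_boundary (rect y1 y2 x1 x2) \<inter> mirror X = {}"
          using R(2) by (auto simp: mem_mirror_iff)
        have "card (outside (mirror X) (rect y1 y2 x1 x2)) = card (outside X (rect x1 x2 y1 y2))"
          using outside_mirror[of X "rect x1 x2 y1 y2"] card_mirror by (simp add: swap_rect)
        then show "(y2 - y1) + (x2 - x1) + int (card (outside (mirror X) (rect y1 y2 x1 x2))) \<le> int m"
          using size by simp
      qed (use m in simp)
      then show ?thesis
        using can_reply_mirror[of m "prod.swap v0" 2 "mirror X" "{}"] by (simp add: mirror_simps)
    next
      case 3
      have "edge_boundary (rect x1 x2 y1 y2) - {} \<subseteq> (row_edges x1 x2 y2 \<union> row_edges x1 x2 (y1 - 1)) \<union>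
          col_edges x2 y1 y2 \<union> col_edges (x1 - 1) y1 y2"
        using rect_boundary by auto
      from card_le_union3[OF this] have "card (edge_boundary (rect x1 x2 y1 y2) - {}) \<le>
          card (row_edges x1 x2 y2 \<union> row_edges x1 x2 (y1 - 1)) + 14 + 14"
        using card_col_edges[of x2 y1 y2] card_col_edges[of "x1 - 1" y1 y2] 3 by simp
      also have "card (row_edges x1 x2 y2 \<union> row_edges x1 x2 (y1 - 1)) \<le> 14 + 14"
        using card_Un_le[of "row_edges x1 x2 y2" "row_edges x1 x2 (y1 - 1)"]
          card_row_edges[of x1 x2 y2] card_row_edges[of x1 x2 "y1 - 1"] 3 by linarith
      finally have "card (edge_boundary (rect x1 x2 y1 y2) - {}) \<le> 2 * m" using m by simp
      then show ?thesis using can_reply_sealing[OF finite_rect R(1,2)] by blast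
    qed
    then show ?thesis by simp
  qed
  then show ?thesis unfolding numeral_3_eq_3 wins_Suc_iff numeral_2_eq_2 by blast
qed

theorem corollary1p4:
  fixes m b :: nat and v0 :: vertex
  assumes "m \<ge> 1" and "b \<ge> 2 * m"
  shows "breaker_wins_within m b v0 40 \<and>
         (m \<ge> 29 \<longrightarrow> breaker_wins_within m b v0 3)"
proof (intro conjI impI)
  have "wins m v0 40 {} {}" using wins_mono[OF wins_within_15[OF assms(1)]] by simp
  then show "breaker_wins_within m b v0 40"
    using wins_imp_breaker_wins_within assms(2) by blast
  show "breaker_wins_within m b v0 3" if "m \<ge> 29"
    using wins_imp_breaker_wins_within assms(2) wins_within_3[OF that] by blast
qed

end
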